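(* There is an absolute constant $C$ such that for every $n\ge 1$ the transience class of the grid sandpile satisfies $\mathrm{tcl}(\texttt{GRID}_n)\le C\,n^{7}$, i.e. $\mathrm{tcl}(\texttt{GRID}_n)=O(n^7)$.
   Context: A sandpile is a finite connected multigraph $G$ with a distinguished vertex $s$ (the sink); $V_o=V(G)\setminus\{s\}$ are the ordinary vertices, $d(v)$ denotes degree (counting multiplicities, including edges to $s$). A configuration is a map $c:V_o\to\mathbb{N}$. An ordinary vertex $v$ is unstable if $c(v)\ge d(v)$; toppling $v$ removes $d(v)$ particles from $v$ and gives each neighbour one particle per common edge (particles sent to $s$ disappear); the sink never topples. Every configuration relaxes by topplings to a unique stable configuration. A configuration $c_2$ is reachable from $c_1$ if particles can be added to $c_1$ so that the result relaxes to $c_2$; a configuration is recurrent if it is reachable from every configuration. The transience class $\mathrm{tcl}(S)$ is the maximum number of particles that can be added (one at a time, starting from the empty configuration, relaxing after each addition) before a recurrent configuration is reached. $\texttt{GRID}_n$ is the sandpile obtained from the $n\times n$ grid graph (vertices $(i,j)$, $1\le i,j\le n$) by adding a sink joined by one edge to each non-corner boundary vertex and by two edges to each of the four corner vertices (so every ordinary vertex has degree 4). *)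

theory Defs
  imports "HOL-Library.Extended_Real"
begin

record 'v sandpile_graph =
  verts :: "'v set"
  mult :: "'v \<Rightarrow> 'v \<Rightarrow> nat"
  sink :: 'v

text \<open>The value \<^term>\<open>mult S u v\<close> is the number of edges joining \<^term>\<open>u\<close> and \<^term>\<open>v\<close>; only its
  values on \<^term>\<open>verts S\<close> are relevant.\<close>

locale sandpile =
  fixes S :: "'v sandpile_graph" (structure)
  assumes finite_verts: "finite (verts S)"
    and sink_in_verts: "sink S \<in> verts S"
    and mult_sym: "\<lbrakk>u \<in> verts S; v \<in> verts S\<rbrakk> \<Longrightarrow> mult S u v = mult S v u"
    and no_loops: "v \<in> verts S \<Longrightarrow> mult S v v = 0"
    and connected: "\<lbrakk>u \<in> verts S; v \<in> verts S\<rbrakk> \<Longrightarrow>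
      (\<lambda>x y. x \<in> verts S \<and> y \<in> verts S \<and> mult S x y > 0)\<^sup>*\<^sup>* u v"

definition ordinary :: "'v sandpile_graph \<Rightarrow> 'v set" where
  "ordinary S = verts S - {sink S}"

definition deg :: "'v sandpile_graph \<Rightarrow> 'v \<Rightarrow> nat" where
  "deg S v = (\<Sum>u\<in>verts S. mult S v u)"

text \<open>A map from the ordinary vertices to the natural numbers is represented by its extension
  by \<open>0\<close>, so that equality of configurations is equality of functions.\<close>

definition configs :: "'v sandpile_graph \<Rightarrow> ('v \<Rightarrow> nat) set" where
  "configs S = {c. \<forall>v. v \<notin> ordinary S \<longrightarrow> c v = 0}"

definition unstable :: "'v sandpile_graph \<Rightarrow> ('v \<Rightarrow> nat) \<Rightarrow> 'v \<Rightarrow> bool" where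
  "unstable S c v \<longleftrightarrow> v \<in> ordinary S \<and> deg S v \<le> c v"

definition stable :: "'v sandpile_graph \<Rightarrow> ('v \<Rightarrow> nat) \<Rightarrow> bool" where
  "stable S c \<longleftrightarrow> (\<forall>v\<in>ordinary S. \<not> unstable S c v)"

text \<open>Toppling is only ever applied to unstable vertices, so the subtraction does not truncate.\<close>

definition topple :: "'v sandpile_graph \<Rightarrow> 'v \<Rightarrow> ('v \<Rightarrow> nat) \<Rightarrow> 'v \<Rightarrow> nat" where
  "topple S v c =
    (\<lambda>u. if u \<in> ordinary S then c u - (if u = v then deg S v else 0) + mult S v u else 0)"

definition toppling_step :: "'v sandpile_graph \<Rightarrow> ('v \<Rightarrow> nat) \<Rightarrow> ('v \<Rightarrow> nat) \<Rightarrow> bool" where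
  "toppling_step S c c' \<longleftrightarrow> (\<exists>v. unstable S c v \<and> c' = topple S v c)"

definition relaxes_to :: "'v sandpile_graph \<Rightarrow> ('v \<Rightarrow> nat) \<Rightarrow> ('v \<Rightarrow> nat) \<Rightarrow> bool" where
  "relaxes_to S c c' \<longleftrightarrow> (toppling_step S)\<^sup>*\<^sup>* c c' \<and> stable S c'"

definition relax :: "'v sandpile_graph \<Rightarrow> ('v \<Rightarrow> nat) \<Rightarrow> ('v \<Rightarrow> nat)" where
  "relax S c = (THE c'. relaxes_to S c c')"

definition reachable :: "'v sandpile_graph \<Rightarrow> ('v \<Rightarrow> nat) \<Rightarrow> ('v \<Rightarrow> nat) \<Rightarrow> bool" where
  "reachable S c\<^sub>1 c\<^sub>2 \<longleftrightarrow> (\<exists>a\<in>configs S. relaxes_to S (\<lambda>v. c\<^sub>1 v + a v) c\<^sub>2)"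

definition recurrent :: "'v sandpile_graph \<Rightarrow> ('v \<Rightarrow> nat) \<Rightarrow> bool" where
  "recurrent S c \<longleftrightarrow> c \<in> configs S \<and> (\<forall>c\<^sub>1\<in>configs S. reachable S c\<^sub>1 c)"

definition add_particles :: "'v sandpile_graph \<Rightarrow> 'v list \<Rightarrow> 'v \<Rightarrow> nat" where
  "add_particles S vs = foldl (\<lambda>c v. relax S (c(v := c v + 1))) (\<lambda>_. 0) vs"

text \<open>The supremum is taken in \<^typ>\<open>enat\<close>, so an upper bound on \<open>tcl S\<close> includes the claim that
  the lengths are bounded; it is \<open>0\<close> if already the empty configuration is recurrent.\<close>

definition tcl :: "'v sandpile_graph \<Rightarrow> enat" where
  "tcl S = Sup {enat (length vs) | vs. set vs \<subseteq> ordinary S \<and>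
     (\<forall>k\<le>length vs. \<not> recurrent S (add_particles S (take k vs)))}"

definition grid_adj :: "nat \<times> nat \<Rightarrow> nat \<times> nat \<Rightarrow> bool" where
  "grid_adj = (\<lambda>(i, j) (k, l).
     i = k \<and> (j = l + 1 \<or> l = j + 1) \<or> j = l \<and> (i = k + 1 \<or> k = i + 1))"

text \<open>One edge to the sink for each side of the square on which the vertex lies: for \<open>n \<ge> 2\<close> this
  is \<open>2\<close> at corners, \<open>1\<close> at the other boundary vertices and \<open>0\<close> inside; for \<open>n = 1\<close> the only
  vertex gets \<open>4\<close>, as needed for degree \<open>4\<close>.\<close>

definition sink_edges :: "nat \<Rightarrow> nat \<times> nat \<Rightarrow> nat" where
  "sink_edges n = (\<lambda>(i, j).
     of_bool (i = 1) + of_bool (i = n) + of_bool (j = 1) + of_bool (j = n))"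

fun grid_mult :: "nat \<Rightarrow> (nat \<times> nat) option \<Rightarrow> (nat \<times> nat) option \<Rightarrow> nat" where
  "grid_mult n (Some p) (Some q) = of_bool (grid_adj p q)"
| "grid_mult n (Some p) None = sink_edges n p"
| "grid_mult n None (Some q) = sink_edges n q"
| "grid_mult n None None = 0"

definition GRID :: "nat \<Rightarrow> (nat \<times> nat) option sandpile_graph" where
  "GRID n = \<lparr>verts = insert None (Some ` ({1..n} \<times> {1..n})), mult = grid_mult n, sink = None\<rparr>"

lemma sandpile_GRID: "sandpile (GRID n)"
proof
  let ?R = "\<lambda>x y. x \<in> verts (GRID n) \<and> y \<in> verts (GRID n) \<and> mult (GRID n) x y > 0"
  show sym: "mult (GRID n) u v = mult (GRID n) v u" for u v
    by (cases u; cases v) (auto simp: GRID_def grid_adj_def)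
  have to_sink: "?R\<^sup>*\<^sup>* (Some (i, j)) None" if "i \<in> {1..n}" "j \<in> {1..n}" for i j
    using that
  proof (induction i)
    case (Suc i)
    show ?case
    proof (cases "i = 0")
      case True
      with Suc.prems show ?thesis
        by (intro r_into_rtranclp) (auto simp: GRID_def sink_edges_def)
    next
      case False
      with Suc.prems have "?R (Some (Suc i, j)) (Some (i, j))"
        by (auto simp: GRID_def grid_adj_def)
      moreover have "?R\<^sup>*\<^sup>* (Some (i, j)) None"
        using False Suc by auto
      ultimately show ?thesis
        by (rule converse_rtranclp_into_rtranclp)
    qed
  qed simp
  have to_sink': "?R\<^sup>*\<^sup>* u None" if "u \<in> verts (GRID n)" for u
    using that to_sink by (auto simp: GRID_def)
  have "symp ?R"
    using sym by (auto intro!: sympI)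
  then have "symp ?R\<^sup>*\<^sup>*"
    by (rule symp_rtranclp)
  then show "?R\<^sup>*\<^sup>* u v" if "u \<in> verts (GRID n)" "v \<in> verts (GRID n)" for u v
    using to_sink'[OF that(1)] to_sink'[OF that(2)] by (meson rtranclp_trans sympD)
qed (auto simp: GRID_def grid_adj_def)

lemma deg_GRID:
  assumes "v \<in> ordinary (GRID n)"
  shows "deg (GRID n) v = 4"
proof -
  obtain i j where v: "v = Some (i, j)" and ij: "i \<in> {1..n}" "j \<in> {1..n}"
    using assms by (auto simp: ordinary_def GRID_def)
  let ?Q = "{1..n} \<times> {1..n}"
  have "deg (GRID n) v = sink_edges n (i, j) + (\<Sum>q\<in>?Q. of_bool (grid_adj (i, j) q))"
    by (simp add: deg_def GRID_def v image_iff sum.reindex)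
  also have "(\<Sum>q\<in>?Q. of_bool (grid_adj (i, j) q)) = card {q \<in> ?Q. grid_adj (i, j) q}"
    by (simp add: of_bool_def sum.If_cases Int_def)
  also have "{q \<in> ?Q. grid_adj (i, j) q} =
      {q. i \<noteq> 1 \<and> q = (i - 1, j)} \<union> {q. i \<noteq> n \<and> q = (i + 1, j)} \<union>
      {q. j \<noteq> 1 \<and> q = (i, j - 1)} \<union> {q. j \<noteq> n \<and> q = (i, j + 1)}"
    (is "_ = ?A \<union> ?B \<union> ?C \<union> ?D")
    using ij by (auto simp: grid_adj_def)
  also have "card \<dots> = card ?A + card ?B + card ?C + card ?D"
    using ij by (subst card_Un_disjoint; (force | simp))+
  also have "sink_edges n (i, j) + \<dots> = 4"
    by (simp add: sink_edges_def)
  finally show ?thesis .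
qed

end

theory Submission
  imports Defs Complex_Main
begin

text \<open>A stable configuration obtained after every vertex has toppled contains no forbidden
  subconfiguration and is therefore recurrent. So if a non-recurrent configuration \<open>c\<close> is reached
  by adding the particles \<open>a\<close>, some vertex \<open>v\<^sub>0\<close> has never toppled, and pairing the balance
  \<open>c = a - \<Delta> z\<close> (\<open>z\<close> counting the topplings) with a nonnegative function \<open>h\<close> that is
  subharmonic off \<open>v\<^sub>0\<close> gives \<open>\<Sum> h a \<le> \<Sum> h c\<close>. On the grid we take for \<open>h\<close> the expected
  number of visits, up to time \<open>T = 8 (n + 1)\<^sup>2\<close>, of a lazy random walk started at \<open>v\<^sub>0\<close> and killed
  at the sink. Then \<open>\<Sum> h \<le> T + 1\<close>, and \<open>h\<close> is at least a constant times \<open>n\<^sup>-\<^sup>5\<close>: the two coordinates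
  are independent one-dimensional walks run for binomially distributed times, and at times of
  order \<open>n\<^sup>2\<close> the one-dimensional kernel is dominated by its lowest eigenfunction.\<close>

section \<open>Vertices that never topple\<close>

text \<open>\<open>z\<close> is the odometer: \<open>z v\<close> counts the topplings of
  \<open>v\<close>. The closure of \<open>toppling_step\<close> forgets these counts, on which all
  later comparisons rest.\<close>

inductive legal :: "'v sandpile_graph \<Rightarrow> ('v \<Rightarrow> nat) \<Rightarrow> ('v \<Rightarrow> nat) \<Rightarrow> ('v \<Rightarrow> nat) \<Rightarrow> bool"
  for S c where
  legal_refl: "legal S c (\<lambda>_. 0) c"
| legal_step: "legal S c z c' \<Longrightarrow> unstable S c' v \<Longrightarrow> legal S c (z(v := z v + 1)) (topple S v c')"

text \<open>With \<open>z\<close> read as 0 at the sink, \<open>deg S v * z v - inflow S z v\<close>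
  is the graph Laplacian of \<open>z\<close> at \<open>v\<close>. The value type stays open because
  odometers are natural and test functions real.\<close>

definition inflow :: "'v sandpile_graph \<Rightarrow> ('v \<Rightarrow> 'a::comm_semiring_1) \<Rightarrow> 'v \<Rightarrow> 'a" where
  "inflow S z v = (\<Sum>w\<in>ordinary S. of_nat (mult S w v) * z w)"

text \<open>Dhar's forbidden subconfigurations, restricted to subsets of \<open>T\<close> so that
  the property can grow with the set of toppled vertices.\<close>

definition no_forbidden :: "'v sandpile_graph \<Rightarrow> ('v \<Rightarrow> nat) \<Rightarrow> 'v set \<Rightarrow> bool" where
  "no_forbidden S c T \<longleftrightarrow>
    (\<forall>F. F \<subseteq> T \<longrightarrow> F \<noteq> {} \<longrightarrow> (\<exists>v\<in>F. (\<Sum>w\<in>F. mult S w v) \<le> c v))"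

lemma legal_imp_rtranclp: "legal S c z c' \<Longrightarrow> (toppling_step S)\<^sup>*\<^sup>* c c'"
  by (induction rule: legal.induct)
    (auto simp: toppling_step_def intro: rtranclp.rtrancl_into_rtrancl)

lemma rtranclp_imp_legal: "(toppling_step S)\<^sup>*\<^sup>* c c' \<Longrightarrow> \<exists>z. legal S c z c'"
proof (induction rule: rtranclp_induct)
  case base
  then show ?case by (blast intro: legal_refl)
next
  case (step y z)
  then show ?case unfolding toppling_step_def by (blast intro: legal_step)
qed

lemma legal_configs: "legal S c z c' \<Longrightarrow> c \<in> configs S \<Longrightarrow> c' \<in> configs S"
  by (induction rule: legal.induct) (auto simp: configs_def topple_def)

context sandpile
begin

lemma finite_ordinary: "finite (ordinary S)"
  using finite_verts by (simp add: ordinary_def)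

lemma mult_sym_ordinary:
  "u \<in> ordinary S \<Longrightarrow> v \<in> ordinary S \<Longrightarrow> mult S u v = mult S v u"
  by (simp add: ordinary_def mult_sym)

lemma deg_eq:
  assumes "v \<in> ordinary S"
  shows "deg S v = mult S v (sink S) + (\<Sum>w\<in>ordinary S. mult S w v)"
proof -
  have "deg S v = mult S v (sink S) + (\<Sum>w\<in>ordinary S. mult S v w)"
    unfolding deg_def ordinary_def
    by (rule sum.remove[OF finite_verts sink_in_verts])
  also have "(\<Sum>w\<in>ordinary S. mult S v w) = (\<Sum>w\<in>ordinary S. mult S w v)"
    using assms by (intro sum.cong) (auto intro: mult_sym_ordinary)
  finally show ?thesis .
qed

lemma inflow_upd:
  assumes "v \<in> ordinary S"
  shows "inflow S (z(v := z v + 1)) u = inflow S z u + of_nat (mult S v u)"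
proof -
  have "inflow S (z(v := z v + 1)) u =
      (\<Sum>w\<in>ordinary S. of_nat (mult S w u) * z w + (if w = v then of_nat (mult S w u) else 0))"
    unfolding inflow_def by (intro sum.cong) (auto simp: algebra_simps)
  also have "\<dots> = inflow S z u + of_nat (mult S v u)"
    using assms by (simp add: inflow_def sum.distrib finite_ordinary)
  finally show ?thesis .
qed

lemma inflow_add: "inflow S (\<lambda>v. z v + z' v) u = inflow S z u + inflow S z' u"
  by (simp add: inflow_def sum.distrib algebra_simps)

lemma inflow_mono:
  fixes z y :: "'v \<Rightarrow> nat"
  shows "(\<And>v. v \<in> ordinary S \<Longrightarrow> z v \<le> y v) \<Longrightarrow> inflow S z u \<le> inflow S y u"
  unfolding inflow_def by (intro sum_mono) (auto intro: mult_left_mono)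

lemma legal_balance:
  assumes "legal S c z c'" "u \<in> ordinary S"
  shows "c' u + deg S u * z u = c u + inflow S z u"
  using assms
proof (induction rule: legal.induct)
  case legal_refl
  then show ?case by (simp add: inflow_def)
next
  case (legal_step z c' v)
  then have "v \<in> ordinary S" "deg S v \<le> c' v"
    by (auto simp: unstable_def)
  with legal_step show ?case
    unfolding inflow_upd[OF \<open>v \<in> ordinary S\<close>] by (auto simp: topple_def)
qed

text \<open>The hypothesis says that performing the topplings \<open>y\<close>, legal or not, leaves
  every vertex below its degree. If \<open>v\<close> were to topple when \<open>z v = y v\<close>
  and \<open>z\<close> is nowhere above \<open>y\<close>, it would hold no more than it holds after
  \<open>y\<close>, which is too little.\<close>

lemma least_action:
  fixes y :: "'v \<Rightarrow> nat"
  assumes "legal S c z c'"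
    and "\<And>u. u \<in> ordinary S \<Longrightarrow> c u + inflow S y u < deg S u * (y u + 1)"
  shows "u \<in> ordinary S \<Longrightarrow> z u \<le> y u"
  using assms(1)
proof (induction arbitrary: u rule: legal.induct)
  case (legal_step z c' v)
  show ?case
  proof (cases "u = v")
    case True
    have v: "v \<in> ordinary S" "deg S v \<le> c' v"
      using legal_step.hyps by (auto simp: unstable_def)
    have "z v \<noteq> y v"
    proof
      assume eq: "z v = y v"
      have "c' v + deg S v * z v = c v + inflow S z v"
        using legal_balance legal_step.hyps(1) v(1) by blast
      also have "\<dots> \<le> c v + inflow S y v"
        using legal_step.IH by (simp add: inflow_mono)
      also have "\<dots> < deg S v * (y v + 1)"
        using assms(2) v(1) by blast
      finally show False
        using eq v(2) by simp
    qed
    with legal_step.IH[OF v(1)] True show ?thesis by simp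
  next
    case False
    with legal_step show ?thesis by simp
  qed
qed simp

text \<open>Least action, applied both ways, makes the odometers of two stabilisations equal; the
  balance equation then makes the results equal.\<close>

lemma relaxes_to_unique:
  assumes "c \<in> configs S" "relaxes_to S c c1" "relaxes_to S c c2"
  shows "c1 = c2"
proof -
  obtain z1 z2 where z: "legal S c z1 c1" "legal S c z2 c2"
    using assms rtranclp_imp_legal unfolding relaxes_to_def by meson
  have least: "z u \<le> z' u"
    if "legal S c z d" "legal S c z' d'" "stable S d'" "u \<in> ordinary S" for z z' d d' u
  proof (rule least_action[OF that(1) _ that(4)])
    fix w assume w: "w \<in> ordinary S"
    have "d' w < deg S w"
      using that(3) w by (auto simp: stable_def unstable_def)
    then show "c w + inflow S z' w < deg S w * (z' w + 1)"
      using legal_balance[OF that(2) w] by simp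
  qed
  have eq: "z1 u = z2 u" if "u \<in> ordinary S" for u
    using least z assms that unfolding relaxes_to_def by (meson order_antisym)
  have "c1 u = c2 u" if "u \<in> ordinary S" for u
  proof -
    have "inflow S z1 u = inflow S z2 u"
      unfolding inflow_def using eq by (intro sum.cong) auto
    with legal_balance[OF z(1) that] legal_balance[OF z(2) that] eq[OF that] show ?thesis by simp
  qed
  moreover have "c1 u = c2 u" if "u \<notin> ordinary S" for u
    using legal_configs[OF z(1)] legal_configs[OF z(2)] assms(1) that by (simp add: configs_def)
  ultimately show ?thesis by blast
qed

lemma relaxes_to_relax:
  assumes "c \<in> configs S" "relaxes_to S c c'"
  shows "relax S c = c'"
  unfolding relax_def using assms relaxes_to_unique by blast

text \<open>The vertex of \<open>F\<close> whose last toppling came first has since received a particle along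
  every edge inside \<open>F\<close>.\<close>

lemma legal_no_forbidden:
  assumes "legal S c z c'" "no_forbidden S c T" "T \<subseteq> ordinary S"
  shows "no_forbidden S c' (T \<union> {v \<in> ordinary S. z v > 0})"
  using assms(1)
proof (induction rule: legal.induct)
  case legal_refl
  then show ?case using assms(2) by simp
next
  case (legal_step z c' v)
  let ?T = "T \<union> {v \<in> ordinary S. z v > 0}"
  have v: "v \<in> ordinary S" "deg S v \<le> c' v"
    using legal_step.hyps by (auto simp: unstable_def)
  have T': "T \<union> {u \<in> ordinary S. (z(v := z v + 1)) u > 0} = insert v ?T"
    using v by auto
  show ?case
    unfolding T' no_forbidden_def
  proof (intro allI impI)
    fix F assume F: "F \<subseteq> insert v ?T" "F \<noteq> {}"
    have finF: "finite F" and Ford: "F \<subseteq> ordinary S"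
      using F v(1) assms(3) finite_ordinary by (auto intro: finite_subset)
    show "\<exists>u\<in>F. (\<Sum>w\<in>F. mult S w u) \<le> topple S v c' u"
    \<comment> \<open>A single vertex passes because there are no loops. Otherwise a vertex
      \<open>u\<close> of \<open>F - {v}\<close> gains the \<open>mult S v u\<close> particles that
      \<open>v\<close> can add to the demand.\<close>
    proof (cases "F = {v}")
      case True
      then show ?thesis
        using v no_loops by (auto simp: ordinary_def)
    next
      case False
      have "F - {v} \<subseteq> ?T"
        using F(1) by blast
      moreover have "F - {v} \<noteq> {}"
        using F(2) False by blast
      ultimately obtain u where u: "u \<in> F - {v}" "(\<Sum>w\<in>F - {v}. mult S w u) \<le> c' u"
        using legal_step.IH unfolding no_forbidden_def by blast
      have "(\<Sum>w\<in>F. mult S w u) \<le> mult S v u + (\<Sum>w\<in>F - {v}. mult S w u)"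
        using sum.remove[OF finF, of v "\<lambda>w. mult S w u"] by (cases "v \<in> F") simp_all
      also have "\<dots> \<le> topple S v c' u"
        using u Ford by (auto simp: topple_def)
      finally show ?thesis using u by blast
    qed
  qed
qed

end

section \<open>Termination, Dhar's recurrence criterion and the pairing bound\<close>

text \<open>The strictly superharmonic \<open>x\<close> serves twice: the mass weighted by
  \<open>x\<close> drops at each toppling, so relaxation terminates, and a multiple of
  \<open>x\<close> supplies the topplings in \<open>recurrentI\<close>.\<close>

locale dissipative_sandpile = sandpile S for S :: "'v sandpile_graph" (structure) +
  fixes x :: "'v \<Rightarrow> nat"
  assumes strictly_superharmonic: "v \<in> ordinary S \<Longrightarrow> inflow S x v < deg S v * x v"
begin

lemma topple_potential:
  assumes "unstable S c v"
  shows "(\<Sum>u\<in>ordinary S. topple S v c u * x u) < (\<Sum>u\<in>ordinary S. c u * x u)"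
proof -
  have v: "v \<in> ordinary S" "deg S v \<le> c v"
    using assms by (auto simp: unstable_def)
  have "(\<Sum>u\<in>ordinary S. topple S v c u * x u) + deg S v * x v =
      (\<Sum>u\<in>ordinary S. topple S v c u * x u + (if u = v then deg S v * x v else 0))"
    using v by (simp add: sum.distrib finite_ordinary)
  also have "\<dots> = (\<Sum>u\<in>ordinary S. c u * x u + mult S u v * x u)"
  proof (rule sum.cong)
    fix u assume u: "u \<in> ordinary S"
    show "topple S v c u * x u + (if u = v then deg S v * x v else 0) =
        c u * x u + mult S u v * x u"
    proof (cases "u = v")
      case True
      then obtain k where "c v = deg S v + k"
        using v(2) le_Suc_ex by blast
      then show ?thesis using True v(1) by (simp add: topple_def algebra_simps)
    next
      case False
      then show ?thesis using u v(1) mult_sym_ordinary[of u v]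
        by (simp add: topple_def algebra_simps)
    qed
  qed simp
  also have "\<dots> = (\<Sum>u\<in>ordinary S. c u * x u) + inflow S x v"
    by (simp add: sum.distrib inflow_def)
  finally show ?thesis
    using strictly_superharmonic[OF v(1)] by linarith
qed

lemma relaxation_exists: "\<exists>c' z. legal S c z c' \<and> stable S c'"
proof -
  have "\<exists>c'. (toppling_step S)\<^sup>*\<^sup>* c c' \<and> stable S c'"
  proof (induction "\<Sum>u\<in>ordinary S. c u * x u" arbitrary: c rule: less_induct)
    case less
    show ?case
    proof (cases "stable S c")
      case False
      then obtain v where v: "unstable S c v" by (auto simp: stable_def)
      then obtain c' where c': "(toppling_step S)\<^sup>*\<^sup>* (topple S v c) c'" "stable S c'"
        using less topple_potential by blast
      moreover have "toppling_step S c (topple S v c)"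
        using v by (auto simp: toppling_step_def)
      ultimately show ?thesis
        by (meson converse_rtranclp_into_rtranclp)
    qed blast
  qed
  then show ?thesis using rtranclp_imp_legal by meson
qed

lemma legal_relax:
  assumes "c \<in> configs S"
  obtains z where "legal S c z (relax S c)" "stable S (relax S c)"
proof -
  obtain c' z where "legal S c z c'" "stable S c'"
    using relaxation_exists by blast
  moreover from this have "relax S c = c'"
    using assms relaxes_to_relax legal_imp_rtranclp by (metis relaxes_to_def)
  ultimately show ?thesis using that by blast
qed

text \<open>Particles are added to \<open>c1\<close> to make it \<open>c + \<Delta> X\<close> for a
  large \<open>X\<close>. By least action it relaxes to \<open>c + \<Delta> w\<close> with
  \<open>0 \<le> w \<le> X\<close>. Where a nonzero \<open>w\<close> is maximal, the absence of
  forbidden subconfigurations yields a vertex that is still unstable; hence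
  \<open>w = 0\<close>.\<close>

lemma recurrentI:
  assumes c: "c \<in> configs S" "stable S c" and nf: "no_forbidden S c (ordinary S)"
  shows "recurrent S c"
  unfolding recurrent_def
proof (intro conjI ballI c(1))
  fix c1 assume c1: "c1 \<in> configs S"
  define K where "K = (\<Sum>v\<in>ordinary S. c1 v)"
  \<comment> \<open>The Laplacian of \<open>x\<close> is at least 1 at ordinary vertices, so that of
    \<open>X\<close> is at least \<open>K\<close>, which bounds every \<open>c1 v\<close>. Hence the
    subtraction in \<open>a\<close> does not truncate.\<close>
  define X where "X v = K * x v" for v
  have inflow_X: "inflow S X v = K * inflow S x v" for v
    by (simp add: inflow_def X_def sum_distrib_left algebra_simps)
  have X: "c1 v + inflow S X v \<le> c v + deg S v * X v" if v: "v \<in> ordinary S" for v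
  proof -
    have "c1 v \<le> K"
      unfolding K_def using v finite_ordinary by (intro member_le_sum) auto
    then have "c1 v + inflow S X v \<le> K * (inflow S x v + 1)"
      by (simp add: inflow_X)
    also have "\<dots> \<le> K * (deg S v * x v)"
      using strictly_superharmonic[OF v] by (intro mult_left_mono) auto
    finally show ?thesis by (simp add: X_def algebra_simps)
  qed
  define a where "a v = (if v \<in> ordinary S then c v + deg S v * X v - (c1 v + inflow S X v) else 0)" for v
  have a: "a \<in> configs S"
    by (simp add: a_def configs_def)
  define e where "e v = c1 v + a v" for v
  have e: "e v + inflow S X v = c v + deg S v * X v" if "v \<in> ordinary S" for v
    using X[OF that] that by (simp add: e_def a_def)
  have e_conf: "e \<in> configs S"
    using a c1 by (simp add: e_def configs_def)
  obtain z c' where z: "legal S e z c'" "stable S c'"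
    using relaxation_exists by blast
  have small: "d v < deg S v" if "stable S d" "v \<in> ordinary S" for d v
    using that by (auto simp: stable_def unstable_def)
  \<comment> \<open>\<open>X\<close> is an admissible competitor: toppling \<open>e\<close>
    according to \<open>X\<close> gives the stable \<open>c\<close>.\<close>
  have zX: "z v \<le> X v" if "v \<in> ordinary S" for v
    using z(1) _ that
  proof (rule least_action)
    fix u assume u: "u \<in> ordinary S"
    show "e u + inflow S X u < deg S u * (X u + 1)"
      using e[OF u] small[OF c(2) u] by simp
  qed
  define w where "w v = X v - z v" for v
  have w: "X v = z v + w v" if "v \<in> ordinary S" for v
    using zX[OF that] by (simp add: w_def)
  have inflow_w: "inflow S X v = inflow S z v + inflow S w v" for v
    unfolding inflow_add[symmetric] inflow_def[of S X] inflow_def[of S "\<lambda>v. z v + w v"]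
    using w by (intro sum.cong) auto
  have bal: "c' v + inflow S w v = c v + deg S v * w v" if v: "v \<in> ordinary S" for v
    using legal_balance[OF z(1) v] e[OF v] w[OF v] inflow_w[of v] by (simp add: algebra_simps)
  have w0: "w v = 0" if v0: "v \<in> ordinary S" for v
  proof (rule ccontr)
    assume "w v \<noteq> 0"
    define m where "m = Max (w ` ordinary S)"
    have m_ge: "w u \<le> m" if "u \<in> ordinary S" for u
      unfolding m_def using that finite_ordinary by simp
    have m_pos: "m > 0"
      using m_ge[OF v0] \<open>w v \<noteq> 0\<close> by simp
    \<comment> \<open>At \<open>u\<close> in \<open>F\<close> the Laplacian of \<open>w\<close> is
      at least the number of edges leaving \<open>F\<close>, sink edges included, because
      \<open>w\<close> drops by at least 1 along each. The particles \<open>c u\<close> cover the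
      edges inside \<open>F\<close>, so together they reach \<open>deg S u\<close>.\<close>
    define F where "F = {u \<in> ordinary S. w u = m}"
    have "m \<in> w ` ordinary S"
      unfolding m_def using v0 finite_ordinary by (intro Max_in) auto
    then have "F \<noteq> {}" "F \<subseteq> ordinary S"
      by (auto simp: F_def)
    then obtain u where u: "u \<in> F" "(\<Sum>w\<in>F. mult S w u) \<le> c u"
      using nf unfolding no_forbidden_def by blast
    have uo: "u \<in> ordinary S" "w u = m"
      using u by (auto simp: F_def)
    define s where "s = (\<Sum>y\<in>ordinary S. mult S y u)"
    have "inflow S w u + s \<le> (\<Sum>y\<in>ordinary S. mult S y u * m + (if y \<in> F then mult S y u else 0))"
      unfolding inflow_def s_def sum.distrib[symmetric]
    proof (rule sum_mono)
      fix y assume y: "y \<in> ordinary S"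
      show "of_nat (mult S y u) * w y + mult S y u
          \<le> mult S y u * m + (if y \<in> F then mult S y u else 0)"
      proof (cases "y \<in> F")
        case True
        then show ?thesis by (simp add: F_def)
      next
        case False
        then have "w y + 1 \<le> m"
          using m_ge[OF y] y by (simp add: F_def)
        then have "mult S y u * (w y + 1) \<le> mult S y u * m"
          by (rule mult_left_mono) simp
        then show ?thesis using False by simp
      qed
    qed
    also have "\<dots> = s * m + (\<Sum>y\<in>F. mult S y u)"
      using \<open>F \<subseteq> ordinary S\<close> finite_ordinary
      by (simp add: sum.distrib s_def sum_distrib_right sum.If_cases Int_absorb1)
    finally have "inflow S w u + s \<le> s * m + c u"
      using u(2) by linarith
    moreover obtain r where r: "deg S u = r + s"
      using deg_eq[OF uo(1)] s_def by blast
    moreover have "r \<le> r * m"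
      using m_pos by simp
    moreover have "c' u + inflow S w u = c u + (r * m + s * m)"
      using bal[OF uo(1)] uo(2) r by (simp add: algebra_simps)
    ultimately have "deg S u \<le> c' u"
      by linarith
    then show False using small[OF z(2) uo(1)] by simp
  qed
  have "c' v = c v" for v
  proof (cases "v \<in> ordinary S")
    case True
    have "inflow S w v = 0"
      unfolding inflow_def using w0 by (intro sum.neutral) auto
    then show ?thesis using bal[OF True] w0[OF True] by simp
  next
    case False
    then show ?thesis
      using c(1) legal_configs[OF z(1) e_conf] by (simp add: configs_def)
  qed
  then have "c' = c" by (rule ext)
  then have "relaxes_to S (\<lambda>v. c1 v + a v) c"
    using legal_imp_rtranclp[OF z(1)] c(2) by (simp add: relaxes_to_def e_def[abs_def])
  then show "reachable S c1 c"
    using a by (auto simp: reachable_def)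
qed

text \<open>\<open>z\<close> totals the topplings of all relaxations so far. The invariant is
  vacuous at the start, survives added particles because counts only rise, and extends to newly
  toppled vertices by \<open>legal_no_forbidden\<close>.\<close>

lemma add_particles_odometer:
  assumes "set vs \<subseteq> ordinary S"
  shows "\<exists>z. (\<forall>u\<in>ordinary S. add_particles S vs u + deg S u * z u = count_list vs u + inflow S z u)
    \<and> add_particles S vs \<in> configs S \<and> stable S (add_particles S vs)
    \<and> no_forbidden S (add_particles S vs) {v \<in> ordinary S. z v > 0}"
  using assms
proof (induction vs rule: rev_induct)
  case Nil
  have "0 < deg S v" if "v \<in> ordinary S" for v
    using strictly_superharmonic[OF that] by (cases "deg S v") auto
  then show ?case
    by (intro exI[of _ "\<lambda>_. 0"])
      (auto simp: add_particles_def inflow_def configs_def stable_def unstable_def no_forbidden_def)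
next
  case (snoc v vs)
  let ?c = "add_particles S vs"
  let ?d = "?c(v := ?c v + 1)"
  have v: "v \<in> ordinary S" using snoc.prems by simp
  from snoc obtain z where z:
    "\<forall>u\<in>ordinary S. ?c u + deg S u * z u = count_list vs u + inflow S z u"
    "?c \<in> configs S" "no_forbidden S ?c {v \<in> ordinary S. z v > 0}"
    by auto
  have d: "?d \<in> configs S"
    using z(2) v by (auto simp: configs_def)
  obtain y where y: "legal S ?d y (relax S ?d)" "stable S (relax S ?d)"
    using legal_relax[OF d] .
  have eq: "add_particles S (vs @ [v]) = relax S ?d"
    by (simp add: add_particles_def)
  have "no_forbidden S ?d {v \<in> ordinary S. z v > 0}"
    unfolding no_forbidden_def
  proof (intro allI impI)
    fix F assume "F \<subseteq> {v \<in> ordinary S. z v > 0}" "F \<noteq> {}"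
    then obtain u where "u \<in> F" "(\<Sum>w\<in>F. mult S w u) \<le> ?c u"
      using z(3) unfolding no_forbidden_def by blast
    moreover have "?c u \<le> ?d u" by simp
    ultimately show "\<exists>u\<in>F. (\<Sum>w\<in>F. mult S w u) \<le> ?d u"
      using le_trans by blast
  qed
  then have "no_forbidden S (relax S ?d)
      ({v \<in> ordinary S. z v > 0} \<union> {v \<in> ordinary S. y v > 0})"
    by (intro legal_no_forbidden[OF y(1)]) auto
  also have "{v \<in> ordinary S. z v > 0} \<union> {v \<in> ordinary S. y v > 0} =
      {v \<in> ordinary S. z v + y v > 0}"
    by auto
  finally have nf: "no_forbidden S (relax S ?d) {v \<in> ordinary S. z v + y v > 0}" .
  have "relax S ?d u + deg S u * (z u + y u) =
      count_list (vs @ [v]) u + inflow S (\<lambda>v. z v + y v) u" if u: "u \<in> ordinary S" for u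
    using legal_balance[OF y(1) u] bspec[OF z(1) u]
    by (cases "u = v") (simp_all add: inflow_add algebra_simps)
  then show ?case
    unfolding eq using nf y(2) legal_configs[OF y(1) d]
    by (intro exI[of _ "\<lambda>v. z v + y v"]) simp
qed

text \<open>\<open>v0\<close> is fixed before \<open>h\<close>, so that \<open>h\<close> can be
  built around it. On the right, stability has replaced the final configuration by
  \<open>deg S\<close>.\<close>

lemma nonrecurrent_bound:
  assumes vs: "set vs \<subseteq> ordinary S" and nr: "\<not> recurrent S (add_particles S vs)"
  obtains v0 where "v0 \<in> ordinary S"
    "\<And>h :: 'v \<Rightarrow> real. (\<And>u. u \<in> ordinary S \<Longrightarrow> h u \<ge> 0) \<Longrightarrow>
      (\<And>u. u \<in> ordinary S - {v0} \<Longrightarrow> deg S u * h u \<le> inflow S h u) \<Longrightarrow>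
      (\<Sum>v\<leftarrow>vs. h v) \<le> (\<Sum>u\<in>ordinary S. deg S u * h u)"
proof -
  let ?c = "add_particles S vs"
  obtain z where z: "\<And>u. u\<in>ordinary S \<Longrightarrow> ?c u + deg S u * z u = count_list vs u + inflow S z u"
    and c: "?c \<in> configs S" "stable S ?c"
    and nf: "no_forbidden S ?c {v \<in> ordinary S. z v > 0}"
    using add_particles_odometer[OF vs] by blast
  have "{v \<in> ordinary S. z v > 0} \<noteq> ordinary S"
    using nf nr recurrentI[OF c] by auto
  then obtain v0 where v0: "v0 \<in> ordinary S" "z v0 = 0"
    by auto
  show ?thesis
  proof (rule that[OF v0(1)])
    fix h :: "'v \<Rightarrow> real"
    assume h: "\<And>u. u \<in> ordinary S \<Longrightarrow> h u \<ge> 0"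
      and sub: "\<And>u. u \<in> ordinary S - {v0} \<Longrightarrow> deg S u * h u \<le> inflow S h u"
    have "(\<Sum>v\<leftarrow>vs. h v) = (\<Sum>u\<in>ordinary S. count_list vs u * h u)"
      using vs
    proof (induction vs)
      case (Cons v vs)
      have "(\<Sum>u\<in>ordinary S. count_list (v # vs) u * h u) =
          (\<Sum>u\<in>ordinary S. count_list vs u * h u + (if u = v then h v else 0))"
        by (intro sum.cong) (auto simp: algebra_simps)
      with Cons show ?case by (simp add: sum.distrib finite_ordinary)
    qed simp
    also have "\<dots> = (\<Sum>u\<in>ordinary S. ?c u * h u) + (\<Sum>u\<in>ordinary S. deg S u * h u * z u)
        - (\<Sum>u\<in>ordinary S. inflow S z u * h u)"
    proof -
      have "real (count_list vs u) * h u = ?c u * h u + deg S u * h u * z u - inflow S z u * h u"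
        if u: "u \<in> ordinary S" for u
      proof -
        have "real (?c u) + deg S u * real (z u) = real (count_list vs u) + real (inflow S z u)"
          using z[OF u] by (simp flip: of_nat_add of_nat_mult)
        then have "real (count_list vs u) = real (?c u) + deg S u * real (z u) - real (inflow S z u)"
          by simp
        then have "real (count_list vs u) * h u =
            (real (?c u) + deg S u * real (z u) - real (inflow S z u)) * h u"
          by (rule arg_cong)
        then show ?thesis by (simp only: algebra_simps)
      qed
      then have "(\<Sum>u\<in>ordinary S. count_list vs u * h u) =
          (\<Sum>u\<in>ordinary S. ?c u * h u + deg S u * h u * z u - inflow S z u * h u)"
        by (rule sum.cong[OF refl])
      then show ?thesis by (simp only: sum.distrib sum_subtractf)
    qed
    \<comment> \<open>Symmetry of \<open>mult\<close> moves the adjacency operator from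
      \<open>z\<close> to \<open>h\<close>.\<close>
    also have "(\<Sum>u\<in>ordinary S. inflow S z u * h u) = (\<Sum>w\<in>ordinary S. inflow S h w * z w)"
    proof -
      have "(\<Sum>u\<in>ordinary S. inflow S z u * h u) =
          (\<Sum>u\<in>ordinary S. \<Sum>w\<in>ordinary S. mult S w u * z w * h u)"
        by (simp add: inflow_def sum_distrib_right)
      also have "\<dots> = (\<Sum>w\<in>ordinary S. \<Sum>u\<in>ordinary S. mult S w u * z w * h u)"
        by (rule sum.swap)
      also have "\<dots> = (\<Sum>w\<in>ordinary S. inflow S h w * z w)"
        unfolding inflow_def sum_distrib_right
        by (intro sum.cong refl) (simp add: mult_sym_ordinary mult_ac)
      finally show ?thesis .
    qed
    also have "(\<Sum>u\<in>ordinary S. ?c u * h u) \<le> (\<Sum>u\<in>ordinary S. deg S u * h u)"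
      using c(2) h by (intro sum_mono mult_right_mono) (auto simp: stable_def unstable_def)
    \<comment> \<open>At \<open>v0\<close> subharmonicity may fail, but there the factor
      \<open>z v0\<close> is 0.\<close>
    also have "(\<Sum>u\<in>ordinary S. deg S u * h u * z u) \<le> (\<Sum>w\<in>ordinary S. inflow S h w * z w)"
    proof (rule sum_mono)
      fix u assume "u \<in> ordinary S"
      then show "deg S u * h u * z u \<le> inflow S h u * z u"
        using sub v0(2) by (cases "u = v0") (auto intro: mult_right_mono)
    qed
    finally show "(\<Sum>v\<leftarrow>vs. h v) \<le> (\<Sum>u\<in>ordinary S. deg S u * h u)"
      by simp
  qed
qed

end

section \<open>The absorbed lazy walk on an interval\<close>

text \<open>Concavity: \<open>f\<close> vanishes at both ends, so a negative value in between would
  force its derivative to be negative at \<open>a\<close> and positive at a later \<open>b\<close>,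
  although \<open>cos\<close> decreases.\<close>

lemma Jordan_sin_ge:
  fixes y :: real
  assumes "0 \<le> y" "y \<le> pi / 2"
  shows "2 * y / pi \<le> sin y"
proof (rule ccontr)
  assume neg: "\<not> 2 * y / pi \<le> sin y"
  define f where "f t = sin t - 2 * t / pi" for t :: real
  have f': "(f has_real_derivative (cos t - 2 / pi)) (at t)" for t
    unfolding f_def by (auto intro!: derivative_eq_intros)
  have ends: "f 0 = 0" "f (pi / 2) = 0" and fy: "f y < 0"
    using neg by (simp_all add: f_def)
  have "y \<noteq> 0" "y \<noteq> pi / 2"
    using ends fy by (metis less_irrefl)+
  then have y: "0 < y" "y < pi / 2"
    using assms by auto
  obtain a where a: "0 < a" "a < y" "f y - f 0 = (y - 0) * (cos a - 2 / pi)"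
    using MVT2[OF y(1) f'] by blast
  obtain b where b: "y < b" "b < pi / 2" "f (pi / 2) - f y = (pi / 2 - y) * (cos b - 2 / pi)"
    using MVT2[OF y(2) f'] by blast
  have "y * (cos a - 2 / pi) < 0" "0 < (pi / 2 - y) * (cos b - 2 / pi)"
    using a(3) b(3) ends fy by auto
  then have "cos a < cos b"
    using y by (auto simp: mult_less_0_iff zero_less_mult_iff)
  moreover have "cos b < cos a"
    using a b y pi_gt_zero by (intro cos_monotone_0_pi) auto
  ultimately show False by simp
qed

text \<open>Compares the \<open>m\<close>-th mode at a point with the lowest mode there, at the
  price of a factor \<open>m\<close>.\<close>

lemma abs_sin_mult_le: "\<bar>sin (real m * y)\<bar> \<le> real m * \<bar>sin y\<bar>"
proof (induction m)
  case (Suc m)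
  have "\<bar>sin (real (Suc m) * y)\<bar> = \<bar>sin (real m * y) * cos y + cos (real m * y) * sin y\<bar>"
    by (simp add: algebra_simps sin_add)
  also have "\<dots> \<le> \<bar>sin (real m * y)\<bar> * \<bar>cos y\<bar> + \<bar>cos (real m * y)\<bar> * \<bar>sin y\<bar>"
    by (metis abs_mult abs_triangle_ineq)
  also have "\<dots> \<le> \<bar>sin (real m * y)\<bar> * 1 + 1 * \<bar>sin y\<bar>"
    by (intro add_mono mult_left_mono mult_right_mono) auto
  finally show ?case using Suc by (simp add: algebra_simps)
qed simp

lemma sum_cos_multiples:
  assumes "N \<ge> 1"
  shows "2 * sin t * (\<Sum>m=1..<N. cos (2 * real m * t)) = sin ((2 * real N - 1) * t) - sin t"
  using assms
proof (induction N rule: dec_induct)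
  case (step N)
  have "2 * sin t * cos (2 * real N * t) = sin ((2 * real N + 1) * t) - sin ((2 * real N - 1) * t)"
    by (simp add: algebra_simps sin_add sin_diff)
  with step show ?case by (simp add: algebra_simps)
qed simp

text \<open>Here \<open>(2 * M - 1) * t = pi * y - t\<close> and \<open>sin (pi * y) = 0\<close>,
  while the bounds on \<open>y\<close> keep \<open>sin t\<close> nonzero. The value depends only on
  the parity of \<open>y\<close>, which drives the cancellation in \<open>walk1_0\<close>.\<close>

lemma sum_cos_half_turn:
  fixes y :: int
  assumes "M \<ge> 1" "y \<noteq> 0" "\<bar>y\<bar> < 2 * int M"
  shows "(\<Sum>m=1..<M. cos (2 * real m * (y * (pi / (2 * real M))))) = (- 1 - cos (pi * y)) / 2"
proof -
  let ?t = "y * (pi / (2 * real M))"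
  have "\<bar>real_of_int y\<bar> < 2 * real M"
    using assms(3) by linarith
  then have "\<bar>?t\<bar> < pi"
    using assms(1) by (simp add: abs_mult field_simps)
  then have t: "sin ?t \<noteq> 0"
    using assms(1,2) sin_eq_0_pi[of ?t] unfolding abs_less_iff by fastforce
  have "(2 * real M - 1) * ?t = pi * y - ?t"
    using assms(1) by (simp add: field_simps)
  then have "sin ((2 * real M - 1) * ?t) = - cos (pi * y) * sin ?t"
    by (simp only: sin_diff sin_npi_int mult_zero_left diff_0 mult_minus_left)
  with sum_cos_multiples[OF assms(1), of ?t] have
    "sin ?t * (2 * (\<Sum>m=1..<M. cos (2 * real m * ?t))) = sin ?t * (- 1 - cos (pi * y))"
    by (simp add: algebra_simps)
  with t have "2 * (\<Sum>m=1..<M. cos (2 * real m * ?t)) = - 1 - cos (pi * y)"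
    by (meson mult_left_cancel)
  then show ?thesis by simp
qed

section \<open>The one-dimensional kernel: initial value, recursion, sign and mass\<close>

text \<open>The probability that a lazy simple random walk on \<open>{0..M}\<close>, absorbed at both ends and
  started at \<open>p\<close>, is at the interior point \<open>i\<close> after \<open>k\<close> steps, in spectral form.\<close>

definition walk1 :: "nat \<Rightarrow> nat \<Rightarrow> nat \<Rightarrow> nat \<Rightarrow> real" where
  "walk1 M p k i = 2 / real M * (\<Sum>m=1..<M. ((cos (real m * (pi / (2 * real M))))\<^sup>2) ^ k *
     (sin (real m * (2 * real p * (pi / (2 * real M)))) *
      sin (real m * (2 * real i * (pi / (2 * real M))))))"

text \<open>Products of sines become differences of cosines with frequencies \<open>p - i\<close>
  and \<open>p + i\<close>. These have equal parity, so the sums cancel unless \<open>i = p\<close>,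
  where they are \<open>M - 1\<close> and \<open>-1\<close>.\<close>

lemma walk1_0:
  assumes "p \<in> {1..<M}" "i \<in> {1..<M}"
  shows "walk1 M p 0 i = of_bool (i = p)"
proof -
  let ?x = "pi / (2 * real M)"
  have M: "M \<ge> 1" using assms by auto
  have "2 * (\<Sum>m=1..<M. sin (real m * (2 * real p * ?x)) * sin (real m * (2 * real i * ?x))) =
      (\<Sum>m=1..<M. cos (2 * real m * ((int p - int i) * ?x)) - cos (2 * real m * ((int p + int i) * ?x)))"
    unfolding sum_distrib_left
  proof (rule sum.cong)
    fix m assume "m \<in> {1..<M}"
    define x where "x = ?x"
    have "cos (2 * real m * ((int p - int i) * x)) =
        cos (real m * (2 * real p * x) - real m * (2 * real i * x))"
      "cos (2 * real m * ((int p + int i) * x)) =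
        cos (real m * (2 * real p * x) + real m * (2 * real i * x))"
      by (simp_all add: algebra_simps)
    then show "2 * (sin (real m * (2 * real p * ?x)) * sin (real m * (2 * real i * ?x))) =
        cos (2 * real m * ((int p - int i) * ?x)) - cos (2 * real m * ((int p + int i) * ?x))"
      unfolding x_def[symmetric] by (simp add: cos_add cos_diff)
  qed simp
  also have "\<dots> = (\<Sum>m=1..<M. cos (2 * real m * ((int p - int i) * ?x)))
      - (\<Sum>m=1..<M. cos (2 * real m * ((int p + int i) * ?x)))"
    by (rule sum_subtractf)
  also have "(\<Sum>m=1..<M. cos (2 * real m * ((int p + int i) * ?x))) =
      (- 1 - cos (pi * (int p + int i))) / 2"
    using sum_cos_half_turn[OF M, of "int p + int i"] assms by simp
  also have "(\<Sum>m=1..<M. cos (2 * real m * ((int p - int i) * ?x))) -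
      (- 1 - cos (pi * (int p + int i))) / 2 = (if i = p then real M else 0)"
  proof (cases "i = p")
    case True
    have "cos (pi * (int p + int p)) = 1"
      using cos_int_2pin[of "int p"] by (simp add: algebra_simps)
    with True M show ?thesis by (simp add: of_nat_diff)
  next
    case False
    have "cos (pi * (int p + int i)) = cos (pi * (int p - int i) + 2 * pi * int i)"
      by (simp add: algebra_simps)
    also have "\<dots> = cos (pi * (int p - int i))"
      using cos_int_2pin[of "int i"] sin_int_2pin[of "int i"]
      unfolding cos_add[of _ "2 * pi * int i"] by simp
    finally have "cos (pi * (int p + int i)) = cos (pi * (int p - int i))" .
    moreover have "\<bar>int p - int i\<bar> < 2 * int M"
      using assms by auto
    then have "(\<Sum>m=1..<M. cos (2 * real m * ((int p - int i) * ?x))) =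
        (- 1 - cos (pi * (int p - int i))) / 2"
      using sum_cos_half_turn[OF M, of "int p - int i"] False by simp
    ultimately show ?thesis using False by simp
  qed
  finally show ?thesis
    using M by (simp add: walk1_def)
qed

lemma walk1_left: "walk1 M p k 0 = 0"
  by (simp add: walk1_def)

lemma walk1_right: "walk1 M p k M = 0"
proof (cases "M = 0")
  case False
  then have "sin (real m * (2 * real M * (pi / (2 * real M)))) = 0" for m
    by simp
  then show ?thesis
    unfolding walk1_def by simp
qed (simp add: walk1_def)

text \<open>Each sine mode is an eigenvector of the step with weights 1/4, 1/2, 1/4, with eigenvalue
  \<open>(1 + cos (2 * b)) / 2 = (cos b)^2\<close>.\<close>

lemma walk1_Suc:
  assumes "i \<ge> 1"
  shows "walk1 M p (Suc k) i = (walk1 M p k (i - 1) + 2 * walk1 M p k i + walk1 M p k (i + 1)) / 4"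
proof -
  define x where "x = pi / (2 * real M)"
  define e where "e m = ((cos (real m * x))\<^sup>2) ^ k * sin (real m * (2 * real p * x))" for m
  have eq: "walk1 M p k j = 2 / real M * (\<Sum>m=1..<M. e m * sin (real m * (2 * real j * x)))" for j
    by (simp add: walk1_def e_def x_def mult.assoc)
  have trig: "(cos (real m * x))\<^sup>2 * sin (real m * (2 * real i * x)) =
      (sin (real m * (2 * real (i - 1) * x)) + 2 * sin (real m * (2 * real i * x)) +
       sin (real m * (2 * real (i + 1) * x))) / 4" for m
  proof -
    define a b where "a = real m * (2 * real i * x)" and "b = real m * x"
    have "real m * (2 * real (i - 1) * x) = a - 2 * b" "real m * (2 * real (i + 1) * x) = a + 2 * b"
      using assms by (simp_all add: a_def b_def of_nat_diff algebra_simps)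
    moreover have "(cos b)\<^sup>2 * sin a = (sin (a - 2 * b) + 2 * sin a + sin (a + 2 * b)) / 4"
      unfolding sin_add sin_diff cos_double_cos by (simp add: algebra_simps)
    ultimately show ?thesis by (simp add: a_def b_def)
  qed
  have "walk1 M p (Suc k) i =
      2 / real M * (\<Sum>m=1..<M. e m * ((cos (real m * x))\<^sup>2 * sin (real m * (2 * real i * x))))"
    by (simp add: walk1_def e_def x_def mult_ac)
  also have "\<dots> = (walk1 M p k (i - 1) + 2 * walk1 M p k i + walk1 M p k (i + 1)) / 4"
    unfolding trig eq
    by (simp add: sum.distrib sum_distrib_left sum_divide_distrib algebra_simps add_divide_distrib)
  finally show ?thesis .
qed

text \<open>The spectral formula hides the sign; the recursion shows it, averaging nonnegative
  values with 0 at both ends.\<close>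

lemma walk1_nonneg:
  assumes "p \<in> {1..<M}" "i \<le> M"
  shows "walk1 M p k i \<ge> 0"
  using assms(2)
proof (induction k arbitrary: i)
  case 0
  then show ?case
    using assms(1) walk1_0[of p M i] walk1_left[of M p 0] walk1_right[of M p 0]
    by (cases "i = 0 \<or> i = M") auto
next
  case (Suc k)
  show ?case
  proof (cases "i = 0 \<or> i = M")
    case True
    then show ?thesis
      using walk1_left[of M p "Suc k"] walk1_right[of M p "Suc k"] by auto
  next
    case False
    then have "walk1 M p k (i - 1) \<ge> 0" "walk1 M p k i \<ge> 0" "walk1 M p k (i + 1) \<ge> 0"
      using Suc.prems by (auto intro!: Suc.IH)
    then show ?thesis
      using False walk1_Suc[of i M p k] by auto
  qed
qed

text \<open>Mass only leaks at the ends: each shifted sum takes the kernel at distinct positions of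
  \<open>{0..M}\<close>, and the two ends contribute 0.\<close>

lemma sum_walk1_le_1:
  assumes p: "p \<in> {1..<M}"
  shows "(\<Sum>i=1..<M. walk1 M p k i) \<le> 1"
proof (induction k)
  case 0
  have "(\<Sum>i=1..<M. walk1 M p 0 i) = (\<Sum>i=1..<M. if i = p then 1 else 0)"
    using p by (intro sum.cong) (auto simp: walk1_0)
  then show ?case by simp
next
  case (Suc k)
  let ?a = "walk1 M p k"
  have full: "(\<Sum>i=0..M. ?a i) = (\<Sum>i=1..<M. ?a i)"
  proof (rule sum.mono_neutral_right)
    show "\<forall>i\<in>{0..M} - {1..<M}. ?a i = 0"
    proof
      fix i assume "i \<in> {0..M} - {1..<M}"
      then have "i = 0 \<or> i = M" by auto
      then show "?a i = 0" using walk1_left walk1_right by auto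
    qed
  qed auto
  have shift: "(\<Sum>i=1..<M. ?a (g i)) \<le> (\<Sum>i=1..<M. ?a i)"
    if "inj_on g {1..<M}" "g ` {1..<M} \<subseteq> {0..M}" for g
  proof -
    have "(\<Sum>i=1..<M. ?a (g i)) = sum ?a (g ` {1..<M})"
      using that(1) by (simp add: sum.reindex)
    also have "\<dots> \<le> (\<Sum>i=0..M. ?a i)"
      using that(2) p by (intro sum_mono2) (auto intro: walk1_nonneg)
    finally show ?thesis by (simp add: full)
  qed
  have "(\<Sum>i=1..<M. walk1 M p (Suc k) i) =
      (\<Sum>i=1..<M. (?a (i - 1) + 2 * ?a i + ?a (i + 1)) / 4)"
    by (intro sum.cong) (auto simp: walk1_Suc)
  also have "\<dots> = ((\<Sum>i=1..<M. ?a (i - 1)) + 2 * (\<Sum>i=1..<M. ?a i) + (\<Sum>i=1..<M. ?a (i + 1))) / 4"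
    by (simp add: sum.distrib sum_distrib_left flip: sum_divide_distrib)
  also have "\<dots> \<le> (\<Sum>i=1..<M. ?a i)"
    using shift[of "\<lambda>i. i - 1"] shift[of "\<lambda>i. i + 1"] by (fastforce simp: inj_on_def)
  finally show ?case using Suc by simp
qed

section \<open>Dominance of the lowest mode\<close>

text \<open>The gap \<open>(cos x)^2 - (cos (m * x))^2\<close> equals
  \<open>sin ((m + 1) * x) * sin ((m - 1) * x)\<close>. As \<open>m < M\<close>, both angles lie
  between 0 and \<open>pi / 2\<close>, and Jordan's inequality bounds the product below by
  \<open>(m^2 - 1) / M^2\<close>.\<close>

lemma cos_squared_le:
  assumes "1 \<le> m" "m < M"
  shows "(cos (real m * (pi / (2 * real M))))\<^sup>2 \<le>
    (cos (pi / (2 * real M)))\<^sup>2 * exp (- ((real m)\<^sup>2 - 1) / (real M)\<^sup>2)"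
proof -
  define x where "x = pi / (2 * real M)"
  define s where "s = ((real m)\<^sup>2 - 1) / (real M)\<^sup>2"
  have x: "2 * (t * x) / pi = t / real M" for t
    using assms by (simp add: x_def)
  have le: "(real m + 1) * x \<le> pi / 2" "(real m - 1) * x \<le> pi / 2" "0 \<le> (real m - 1) * x" "0 \<le> x"
  proof -
    have "real m + 1 \<le> real M" using assms by linarith
    then have "(real m + 1) * pi \<le> real M * pi" by (intro mult_right_mono) auto
    then show "(real m + 1) * x \<le> pi / 2" using assms by (simp add: x_def field_simps)
    moreover show "0 \<le> x" by (simp add: x_def)
    ultimately show "(real m - 1) * x \<le> pi / 2" "0 \<le> (real m - 1) * x"
      using assms by (auto simp: left_diff_distrib distrib_right mult_le_cancel_right1)
  qed
  have "0 \<le> sin ((real m + 1) * x)"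
    using le pi_gt_zero by (intro sin_ge_zero) (simp, linarith)
  moreover have "s = ((real m + 1) / real M) * ((real m - 1) / real M)"
    by (simp add: s_def power2_eq_square algebra_simps)
  moreover have "((real m + 1) / real M) * ((real m - 1) / real M) \<le>
      sin ((real m + 1) * x) * sin ((real m - 1) * x)"
    using Jordan_sin_ge[of "(real m + 1) * x"] Jordan_sin_ge[of "(real m - 1) * x"] le assms calculation(1)
    unfolding x by (intro mult_mono) auto
  ultimately have "s \<le> sin ((real m + 1) * x) * sin ((real m - 1) * x)"
    by simp
  also have "\<dots> = (sin (real m * x))\<^sup>2 * (cos x)\<^sup>2 - (cos (real m * x))\<^sup>2 * (sin x)\<^sup>2"
    by (simp add: distrib_right left_diff_distrib sin_add sin_diff algebra_simps power2_eq_square)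
  also have "\<dots> = (cos x)\<^sup>2 - (cos (real m * x))\<^sup>2"
    unfolding sin_squared_eq by (simp add: algebra_simps)
  finally have "(cos (real m * x))\<^sup>2 \<le> (cos x)\<^sup>2 - s"
    by simp
  also have "\<dots> \<le> (cos x)\<^sup>2 * (1 - s)"
  proof -
    have "0 \<le> s" using assms by (simp add: s_def)
    then have "(cos x)\<^sup>2 * s \<le> 1 * s"
      by (intro mult_right_mono) (simp_all add: cos_squared_eq)
    then show ?thesis by (simp add: algebra_simps)
  qed
  also have "\<dots> \<le> (cos x)\<^sup>2 * exp (- s)"
    using exp_ge_add_one_self[of "- s"] by (intro mult_left_mono) auto
  finally show ?thesis by (simp add: x_def s_def minus_divide_left)
qed

lemma exp_ge_power_2: "2 ^ j \<le> exp (real j)"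
proof -
  have "(2::real) ^ j \<le> exp 1 ^ j"
    using exp_ge_add_one_self[of 1] by (intro power_mono) auto
  then show ?thesis by (simp add: exp_of_nat_mult[symmetric])
qed

text \<open>Bounds mode \<open>m\<close> against the lowest one at time \<open>2 * M^2\<close>. It
  rests on \<open>m \<le> 2 ^ m\<close> and \<open>3 * m \<le> 2 * (m^2 - 1)\<close>, the latter
  sharp at \<open>m = 2\<close>.\<close>

lemma square_exp_le:
  assumes "m \<ge> 2"
  shows "(real m)\<^sup>2 * exp (- 2 * ((real m)\<^sup>2 - 1)) \<le> (1 / 2) ^ m"
proof -
  obtain j where j: "m = 2 + j" using assms le_Suc_ex by blast
  have e: "3 * m \<le> 2 * (m\<^sup>2 - 1)"
    by (simp add: j power2_eq_square)
  have "real m \<le> 2 ^ m"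
    using of_nat_less_two_power[of m, where ?'a = real] by simp
  then have "(real m)\<^sup>2 * 2 ^ m \<le> (2 ^ m)\<^sup>2 * 2 ^ m"
    by (intro mult_right_mono power_mono) auto
  also have "\<dots> = 2 ^ (3 * m)"
    by (simp flip: power_mult power_add add: algebra_simps)
  also have "\<dots> \<le> 2 ^ (2 * (m\<^sup>2 - 1))"
    using e by (intro power_increasing) auto
  also have "\<dots> \<le> exp (real (2 * (m\<^sup>2 - 1)))"
    by (rule exp_ge_power_2)
  also have "real (2 * (m\<^sup>2 - 1)) = 2 * ((real m)\<^sup>2 - 1)"
    using assms by (simp add: of_nat_diff)
  finally have "(real m)\<^sup>2 * 2 ^ m \<le> exp (2 * ((real m)\<^sup>2 - 1))" .
  then have "(real m)\<^sup>2 * 2 ^ m * exp (- (2 * ((real m)\<^sup>2 - 1))) \<le> 1"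
    by (subst exp_minus) (simp add: field_simps)
  then show ?thesis
    by (simp add: field_simps)
qed

lemma sum_half_powers_le: "(\<Sum>m=2..<N. (1 / 2 :: real) ^ m) \<le> 1 / 2"
proof (cases "N \<ge> 2")
  case True
  then have "(\<Sum>m=2..<N. (1 / 2 :: real) ^ m) = 1 / 2 - 2 * (1 / 2) ^ N"
    by (induction N rule: dec_induct) (simp_all add: power2_eq_square)
  then show ?thesis by simp
qed simp

text \<open>Jordan's inequality in the left half, reflection \<open>i\<close> to
  \<open>M - i\<close> in the right half.\<close>

lemma sin_interior_ge:
  assumes "i \<in> {1..<M}"
  shows "2 / real M \<le> sin (2 * real i * (pi / (2 * real M)))"
proof -
  have *: "2 / real M \<le> sin (2 * real i * (pi / (2 * real M)))" if "1 \<le> i" "2 * i \<le> M" for i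
  proof -
    have "2 * real i \<le> real M" using that by linarith
    then have "2 * real i * (pi / (2 * real M)) \<le> pi / 2"
      using that by (simp add: field_simps)
    then have "2 * (2 * real i * (pi / (2 * real M))) / pi \<le> sin (2 * real i * (pi / (2 * real M)))"
      by (intro Jordan_sin_ge) auto
    moreover have "2 / real M \<le> 2 * (2 * real i * (pi / (2 * real M))) / pi"
      using that by (simp add: divide_right_mono)
    ultimately show ?thesis by linarith
  qed
  show ?thesis
  proof (cases "2 * i \<le> M")
    case False
    have "2 * real (M - i) * (pi / (2 * real M)) = pi - 2 * real i * (pi / (2 * real M))"
      using assms by (simp add: of_nat_diff field_simps)
    with *[of "M - i"] False assms show ?thesis by auto
  qed (use assms * in auto)
qed

text \<open>From time \<open>2 * M\<^sup>2\<close> on the lowest mode dominates the sum of all the others.\<close>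

lemma walk1_ge:
  assumes p: "p \<in> {1..<M}" and i: "i \<in> {1..<M}" and k: "2 * M\<^sup>2 \<le> k" "k \<le> 4 * M\<^sup>2"
  shows "4 * exp (- 2 * pi\<^sup>2) / real M ^ 3 \<le> walk1 M p k i"
proof -
  define x where "x = pi / (2 * real M)"
  define A where "A = sin (2 * real p * x)"
  define B where "B = sin (2 * real i * x)"
  define D where "D = ((cos x)\<^sup>2) ^ k"
  define w where "w m = ((cos (real m * x))\<^sup>2) ^ k *
    (sin (real m * (2 * real p * x)) * sin (real m * (2 * real i * x)))" for m
  have M: "M \<ge> 2" using p by auto
  have AB: "2 / real M \<le> A" "2 / real M \<le> B"
    using sin_interior_ge p i by (auto simp: A_def B_def x_def)
  moreover have "0 \<le> 2 / real M" by simp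
  ultimately have AB0: "0 \<le> A" "0 \<le> B" by linarith+
  have D0: "0 \<le> D" by (simp add: D_def)
  \<comment> \<open>The two sine factors cost \<open>m^2\<close>; the lower bound on
    \<open>k\<close> turns the eigenvalue ratio into the exponential of
    \<open>square_exp_le\<close>.\<close>
  have small: "- (A * B * D * (1 / 2) ^ m) \<le> w m" if m: "m \<in> {2..<M}" for m
  proof -
    have m1: "1 \<le> (real m)\<^sup>2" using m by simp
    have k': "2 * (real M)\<^sup>2 \<le> real k"
      using k(1) by (metis of_nat_le_iff of_nat_mult of_nat_numeral of_nat_power)
    have "((cos (real m * x))\<^sup>2) ^ k \<le> ((cos x)\<^sup>2 * exp (- ((real m)\<^sup>2 - 1) / (real M)\<^sup>2)) ^ k"
      using cos_squared_le[of m M] m unfolding x_def by (intro power_mono) auto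
    also have "\<dots> = D * exp (real k * (- ((real m)\<^sup>2 - 1) / (real M)\<^sup>2))"
      by (simp only: D_def power_mult_distrib exp_of_nat_mult)
    also have "\<dots> \<le> D * exp (- 2 * ((real m)\<^sup>2 - 1))"
    proof -
      have "2 * (real M)\<^sup>2 * (((real m)\<^sup>2 - 1) / (real M)\<^sup>2) \<le> real k * (((real m)\<^sup>2 - 1) / (real M)\<^sup>2)"
        using k' m1 by (intro mult_right_mono) auto
      moreover have "2 * (real M)\<^sup>2 * (((real m)\<^sup>2 - 1) / (real M)\<^sup>2) = 2 * ((real m)\<^sup>2 - 1)"
        using M by simp
      moreover have "real k * (- ((real m)\<^sup>2 - 1) / (real M)\<^sup>2) =
          - (real k * (((real m)\<^sup>2 - 1) / (real M)\<^sup>2))"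
        by (simp only: minus_divide_left[symmetric] mult_minus_right)
      ultimately have "real k * (- ((real m)\<^sup>2 - 1) / (real M)\<^sup>2) \<le> - 2 * ((real m)\<^sup>2 - 1)"
        by linarith
      then show ?thesis using D0 by (intro mult_left_mono) auto
    qed
    finally have c: "((cos (real m * x))\<^sup>2) ^ k \<le> D * exp (- 2 * ((real m)\<^sup>2 - 1))" .
    have "\<bar>w m\<bar> = ((cos (real m * x))\<^sup>2) ^ k *
        (\<bar>sin (real m * (2 * real p * x))\<bar> * \<bar>sin (real m * (2 * real i * x))\<bar>)"
      by (simp add: w_def abs_mult power_abs)
    also have "\<dots> \<le> (D * exp (- 2 * ((real m)\<^sup>2 - 1))) * ((real m * A) * (real m * B))"
      using c abs_sin_mult_le[of m "2 * real p * x"] abs_sin_mult_le[of m "2 * real i * x"] AB0 D0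
      by (intro mult_mono) (auto simp: A_def B_def)
    also have "\<dots> = A * B * D * ((real m)\<^sup>2 * exp (- 2 * ((real m)\<^sup>2 - 1)))"
      by (simp add: power2_eq_square)
    also have "\<dots> \<le> A * B * D * (1 / 2) ^ m"
      using square_exp_le[of m] m AB0 D0 by (intro mult_left_mono) auto
    finally show ?thesis by linarith
  qed
  \<comment> \<open>From \<open>ln (1 - s) \<ge> - s - 2 * s^2 \<ge> - 2 * s\<close> for
    \<open>s \<le> 1 / 2\<close> one gets \<open>(cos x)^2 \<ge> exp (- 2 * x^2)\<close>. The upper
    bound on \<open>k\<close> makes the exponent at least
    \<open>- 4 * M^2 * 2 * x^2 = - 2 * pi^2\<close>.\<close>
  have D_ge: "exp (- 2 * pi\<^sup>2) \<le> D"
  proof -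
    have x: "0 \<le> x" "x \<le> pi / 4"
      using M by (auto simp: x_def field_simps)
    define s where "s = (sin x)\<^sup>2"
    have s_half: "s \<le> 1 / 2"
    proof -
      have "sin x \<le> sin (pi / 4)"
        using x by (intro sin_monotone_2pi_le) auto
      then have "s \<le> (sin (pi / 4))\<^sup>2"
        unfolding s_def using x pi_gt_zero by (intro power_mono sin_ge_zero) auto
      then show ?thesis by (simp add: sin_45 power_divide)
    qed
    have s_x: "s \<le> x\<^sup>2"
      unfolding s_def using abs_sin_x_le_abs_x[of x] by (simp add: abs_le_square_iff)
    have s0: "0 \<le> s" by (simp add: s_def)
    have "- s - 2 * s\<^sup>2 \<le> ln (1 - s)"
      using s0 s_half by (rule ln_one_minus_pos_lower_bound)
    moreover have "s\<^sup>2 \<le> s * (1 / 2)"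
      unfolding power2_eq_square using s0 s_half by (intro mult_left_mono)
    ultimately have "- 2 * x\<^sup>2 \<le> ln (1 - s)"
      using s_x by linarith
    moreover have "0 < 1 - s" using s_half by simp
    ultimately have "exp (- 2 * x\<^sup>2) \<le> 1 - s"
      by (simp only: ln_ge_iff)
    then have "exp (- 2 * x\<^sup>2) ^ k \<le> (1 - s) ^ k"
      by (intro power_mono) auto
    also have "\<dots> = D"
      by (simp add: D_def s_def cos_squared_eq)
    finally have "exp (real k * (- 2 * x\<^sup>2)) \<le> D"
      by (simp only: exp_of_nat_mult)
    moreover have "- 2 * pi\<^sup>2 \<le> real k * (- 2 * x\<^sup>2)"
    proof -
      have "real k \<le> 4 * (real M)\<^sup>2"
        using k(2) by (metis of_nat_le_iff of_nat_mult of_nat_numeral of_nat_power)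
      then have "real k * (2 * x\<^sup>2) \<le> 4 * (real M)\<^sup>2 * (2 * x\<^sup>2)"
        by (intro mult_right_mono) auto
      also have "\<dots> = 2 * pi\<^sup>2"
        using M by (simp add: x_def power_divide power_mult_distrib)
      finally show ?thesis by simp
    qed
    ultimately show ?thesis
      by (meson exp_le_cancel_iff order_trans)
  qed
  have "(\<Sum>m=1..<M. w m) = w 1 + (\<Sum>m=2..<M. w m)"
    using M by (simp add: sum.atLeast_Suc_lessThan numeral_2_eq_2)
  \<comment> \<open>The higher modes cancel at most half of the lowest.\<close>
  also have "\<dots> \<ge> A * B * D - A * B * D * (1 / 2)"
  proof -
    have "A * B * D * (\<Sum>m=2..<M. (1 / 2) ^ m) \<le> A * B * D * (1 / 2)"
      using sum_half_powers_le AB0 D0 by (intro mult_left_mono) auto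
    moreover have "- (A * B * D * (\<Sum>m=2..<M. (1 / 2) ^ m)) \<le> (\<Sum>m=2..<M. w m)"
      unfolding sum_distrib_left sum_negf[symmetric] using small by (intro sum_mono) auto
    moreover have "w 1 = A * B * D"
      by (simp add: w_def A_def B_def D_def)
    ultimately show ?thesis by linarith
  qed
  finally have "A * B * D * (1 / 2) \<le> (\<Sum>m=1..<M. w m)"
    by simp
  moreover have "(2 / real M) * (2 / real M) * exp (- 2 * pi\<^sup>2) \<le> A * B * D"
    using AB AB0 D_ge D0 by (intro mult_mono) auto
  ultimately have "2 / (real M)\<^sup>2 * exp (- 2 * pi\<^sup>2) \<le> (\<Sum>m=1..<M. w m)"
    by (simp add: power2_eq_square)
  then have "2 / real M * (2 / (real M)\<^sup>2 * exp (- 2 * pi\<^sup>2)) \<le> 2 / real M * (\<Sum>m=1..<M. w m)"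
    by (intro mult_left_mono) auto
  moreover have "walk1 M p k i = 2 / real M * (\<Sum>m=1..<M. w m)"
    by (simp add: walk1_def w_def x_def)
  ultimately show ?thesis
    by (simp add: power3_eq_cube power2_eq_square)
qed

text \<open>The squared form is inductive: consecutive central coefficients have ratio
  \<open>2 * (2 * r + 1) / (r + 1)\<close>, and the step reduces to
  \<open>4 * r * (r + 1) \<le> (2 * r + 1)^2\<close>.\<close>

lemma central_binomial_ge:
  assumes "r \<ge> 1"
  shows "1 / (2 * sqrt (real r)) \<le> real (2 * r choose r) / 4 ^ r"
proof -
  have "16 ^ r \<le> 4 * r * (2 * r choose r)\<^sup>2"
    using assms
  proof (induction r rule: dec_induct)
    case (step r)
    have "(r + 1) * (2 * (r + 1) choose (r + 1)) = 2 * (2 * r + 1) * (2 * r choose r)"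
    proof -
      have "Suc r * (Suc (2 * r + 1) choose Suc r) = Suc (2 * r + 1) * (2 * r + 1 choose r)"
        using Suc_times_binomial_eq[of "2 * r + 1" r] by (simp only: mult.commute)
      moreover have "(r + 1) * (2 * r + 1 choose r) = (2 * r + 1) * (2 * r choose r)"
        using Suc_times_binomial_eq[of "2 * r" r] binomial_symmetric[of r "2 * r + 1"]
        by (simp add: algebra_simps)
      ultimately show ?thesis by (simp add: algebra_simps)
    qed
    then have "((r + 1) * (2 * (r + 1) choose (r + 1)))\<^sup>2 = (2 * (2 * r + 1) * (2 * r choose r))\<^sup>2"
      by simp
    then have eq: "(r + 1) * (4 * (r + 1) * (2 * (r + 1) choose (r + 1))\<^sup>2) =
        16 * (2 * r + 1)\<^sup>2 * (2 * r choose r)\<^sup>2"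
      by (simp add: power2_eq_square algebra_simps)
    have "(r + 1) * 16 ^ Suc r = 16 * (r + 1) * 16 ^ r"
      by (simp add: algebra_simps)
    also have "\<dots> \<le> 16 * (r + 1) * (4 * r * (2 * r choose r)\<^sup>2)"
      using step.IH by (intro mult_left_mono) auto
    also have "\<dots> = 16 * (4 * r * (r + 1)) * (2 * r choose r)\<^sup>2"
      by (simp add: algebra_simps)
    also have "\<dots> \<le> 16 * (2 * r + 1)\<^sup>2 * (2 * r choose r)\<^sup>2"
      by (intro mult_right_mono mult_left_mono) (auto simp: power2_eq_square algebra_simps)
    finally have "(r + 1) * 16 ^ Suc r \<le> (r + 1) * (4 * (r + 1) * (2 * (r + 1) choose (r + 1))\<^sup>2)"
      unfolding eq .
    then have "16 ^ Suc r \<le> 4 * (r + 1) * (2 * (r + 1) choose (r + 1))\<^sup>2"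
      by (subst (asm) nat_mult_le_cancel1) simp
    then show ?case by (simp only: Suc_eq_plus1)
  qed simp
  then have "real (16 ^ r) \<le> real (4 * r * (2 * r choose r)\<^sup>2)"
    by (rule of_nat_mono)
  also have "real (16 ^ r) = (4 ^ r)\<^sup>2"
    by (simp add: power_mult[symmetric] mult.commute[of r] power_mult)
  also have "real (4 * r * (2 * r choose r)\<^sup>2) = (2 * sqrt (real r) * (2 * r choose r))\<^sup>2"
    by (simp add: power_mult_distrib)
  finally have "4 ^ r \<le> 2 * sqrt (real r) * (2 * r choose r)"
    by (rule power2_le_imp_le) simp
  then show ?thesis using assms by (simp add: field_simps)
qed

section \<open>The killed lazy walk on the square\<close>

text \<open>Pascal's rule splits a binomial convolution according to which of the two walks makes
  the extra step.\<close>

lemma sum_Pascal: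
  fixes a b :: "nat \<Rightarrow> real"
  shows "(\<Sum>k\<le>Suc t. real (Suc t choose k) * (a k * b (Suc t - k))) =
    (\<Sum>k\<le>t. real (t choose k) * (a (Suc k) * b (t - k) + a k * b (Suc t - k)))"
proof -
  have "(\<Sum>k\<le>Suc t. real (t choose k) * (a k * b (Suc t - k))) =
      (\<Sum>k\<le>t. real (t choose k) * (a k * b (Suc t - k)))"
    by simp
  then have "a 0 * b (Suc t) + (\<Sum>k\<le>t. real (t choose Suc k) * (a (Suc k) * b (t - k))) =
      (\<Sum>k\<le>t. real (t choose k) * (a k * b (Suc t - k)))"
    by (subst (asm) sum.atMost_Suc_shift) simp
  then show ?thesis
    by (subst sum.atMost_Suc_shift) (simp add: distrib_right distrib_left sum.distrib)
qed

text \<open>Each step of the lazy walk in the square moves one of two independent one-dimensional lazy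
  walks, chosen by a fair coin.\<close>

definition walk2 :: "nat \<Rightarrow> nat \<Rightarrow> nat \<Rightarrow> nat \<Rightarrow> nat \<Rightarrow> nat \<Rightarrow> real" where
  "walk2 M p q t i j = (\<Sum>k\<le>t. real (t choose k) * (walk1 M p k i * walk1 M q (t - k) j)) / 2 ^ t"

text \<open>A fair choice of coordinate followed by a lazy step stays put with probability 1/2 and
  reaches each neighbour with probability 1/8; the factor 8 clears denominators.\<close>

lemma walk2_Suc:
  assumes "i \<ge> 1" "j \<ge> 1"
  shows "8 * walk2 M p q (Suc t) i j = 4 * walk2 M p q t i j +
    (walk2 M p q t (i - 1) j + walk2 M p q t (i + 1) j +
     walk2 M p q t i (j - 1) + walk2 M p q t i (j + 1))"
proof -
  let ?a = "walk1 M p" and ?b = "walk1 M q"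
  have step: "4 * (?a (Suc k) i * ?b (t - k) j + ?a k i * ?b (Suc t - k) j) =
      4 * (?a k i * ?b (t - k) j) + (?a k (i - 1) * ?b (t - k) j + ?a k (i + 1) * ?b (t - k) j +
      ?a k i * ?b (t - k) (j - 1) + ?a k i * ?b (t - k) (j + 1))" if "k \<le> t" for k
    using that
    by (simp add: Suc_diff_le walk1_Suc[OF assms(1)] walk1_Suc[OF assms(2)] field_simps)
  have halve: "8 * (X / 2 ^ Suc t) = 4 * X / 2 ^ t" for X :: real
    by simp
  have "8 * walk2 M p q (Suc t) i j =
      (\<Sum>k\<le>t. real (t choose k) * (4 * (?a (Suc k) i * ?b (t - k) j + ?a k i * ?b (Suc t - k) j))) / 2 ^ t"
    unfolding walk2_def sum_Pascal[of t "\<lambda>k. ?a k i" "\<lambda>k. ?b k j"] halve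
    by (simp only: sum_distrib_left mult.left_commute)
  also have "\<dots> = (\<Sum>k\<le>t. real (t choose k) * (4 * (?a k i * ?b (t - k) j) +
      (?a k (i - 1) * ?b (t - k) j + ?a k (i + 1) * ?b (t - k) j +
       ?a k i * ?b (t - k) (j - 1) + ?a k i * ?b (t - k) (j + 1)))) / 2 ^ t"
    using step by (intro arg_cong[where f = "\<lambda>s. s / 2 ^ t"] sum.cong) simp_all
  also have "\<dots> = 4 * walk2 M p q t i j +
    (walk2 M p q t (i - 1) j + walk2 M p q t (i + 1) j +
     walk2 M p q t i (j - 1) + walk2 M p q t i (j + 1))"
    by (simp add: walk2_def distrib_left sum.distrib sum_distrib_left add_divide_distrib mult_ac)
  finally show ?thesis .
qed

lemma walk2_0:
  assumes "p \<in> {1..<M}" "q \<in> {1..<M}" "i \<in> {1..<M}" "j \<in> {1..<M}"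
  shows "walk2 M p q 0 i j = of_bool (i = p \<and> j = q)"
  using walk1_0[of p M i] walk1_0[of q M j] assms by (simp add: walk2_def)

lemma walk2_nonneg:
  assumes "p \<in> {1..<M}" "q \<in> {1..<M}" "i \<le> M" "j \<le> M"
  shows "walk2 M p q t i j \<ge> 0"
  unfolding walk2_def using assms
  by (intro divide_nonneg_nonneg sum_nonneg mult_nonneg_nonneg walk1_nonneg) auto

lemma walk2_boundary: "i = 0 \<or> i = M \<or> j = 0 \<or> j = M \<Longrightarrow> walk2 M p q t i j = 0"
  unfolding walk2_def using walk1_left walk1_right by auto

lemma sum_walk2_le_1:
  assumes "p \<in> {1..<M}" "q \<in> {1..<M}"
  shows "(\<Sum>i=1..<M. \<Sum>j=1..<M. walk2 M p q t i j) \<le> 1"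
proof -
  let ?A = "\<lambda>k. \<Sum>i=1..<M. walk1 M p k i" and ?B = "\<lambda>k. \<Sum>j=1..<M. walk1 M q k j"
  have "(\<Sum>i=1..<M. \<Sum>j=1..<M. walk2 M p q t i j) =
      (\<Sum>i=1..<M. \<Sum>k\<le>t. real (t choose k) * (walk1 M p k i * ?B (t - k))) / 2 ^ t"
    unfolding walk2_def sum_distrib_left sum_divide_distrib
    by (intro sum.cong refl sum.swap)
  also have "(\<Sum>i=1..<M. \<Sum>k\<le>t. real (t choose k) * (walk1 M p k i * ?B (t - k))) =
      (\<Sum>k\<le>t. real (t choose k) * (?A k * ?B (t - k)))"
    by (subst sum.swap) (simp flip: sum_distrib_left sum_distrib_right)
  also have "\<dots> \<le> (\<Sum>k\<le>t. real (t choose k) * 1)"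
  proof (intro sum_mono mult_left_mono)
    fix k
    show "?A k * ?B (t - k) \<le> 1"
      using assms by (intro mult_le_one sum_walk1_le_1 sum_nonneg walk1_nonneg) auto
  qed auto
  also have "\<dots> = 2 ^ t"
    by (simp add: choose_row_sum flip: of_nat_sum)
  finally show ?thesis by (simp add: divide_right_mono)
qed

text \<open>Only even times \<open>2 * r\<close> with \<open>r\<close> in \<open>?R\<close> are
  kept, and of each only the central term, where both coordinates run for \<open>r\<close> steps.
  Its weight is at least \<open>1 / (4 * M)\<close> since \<open>r \<le> 4 * M^2\<close>, and more
  than \<open>2 * M^2\<close> such times occur.\<close>

lemma sum_walk2_ge:
  assumes "p \<in> {1..<M}" "q \<in> {1..<M}" "i \<in> {1..<M}" "j \<in> {1..<M}"
  shows "8 * exp (- 4 * pi\<^sup>2) / real M ^ 5 \<le> (\<Sum>t\<le>8 * M\<^sup>2. walk2 M p q t i j)"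
proof -
  have M: "M \<ge> 2" using assms by auto
  let ?R = "{2 * M\<^sup>2..4 * M\<^sup>2}"
  let ?c = "4 * exp (- 2 * pi\<^sup>2) / real M ^ 3"
  have each: "1 / (4 * real M) * (?c * ?c) \<le> walk2 M p q (2 * r) i j" if r: "r \<in> ?R" for r
  proof -
    have r1: "r \<ge> 1" using r M by (auto intro: order_trans[rotated])
    have "real r \<le> (2 * real M)\<^sup>2"
      using r by (simp add: power_mult_distrib) (metis of_nat_le_iff of_nat_mult of_nat_numeral of_nat_power)
    then have "sqrt (real r) \<le> 2 * real M"
      by (simp add: real_le_lsqrt)
    then have "1 / (4 * real M) \<le> 1 / (2 * sqrt (real r))"
      using r1 M by (intro divide_left_mono) auto
    then have b: "1 / (4 * real M) \<le> real (2 * r choose r) / 4 ^ r"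
      using central_binomial_ge[OF r1] by linarith
    have "1 / (4 * real M) * (?c * ?c) \<le>
        real (2 * r choose r) / 4 ^ r * (walk1 M p r i * walk1 M q r j)"
      using b walk1_ge[OF assms(1,3), of r] walk1_ge[OF assms(2,4), of r] r assms
      by (intro mult_mono mult_nonneg_nonneg walk1_nonneg) auto
    also have "\<dots> = real (2 * r choose r) * (walk1 M p r i * walk1 M q (2 * r - r) j) / 2 ^ (2 * r)"
      by (simp add: power_mult)
    also have "\<dots> \<le> walk2 M p q (2 * r) i j"
      unfolding walk2_def using assms
      by (intro divide_right_mono member_le_sum[where f = "\<lambda>k. real (2 * r choose k) *
            (walk1 M p k i * walk1 M q (2 * r - k) j)"] mult_nonneg_nonneg walk1_nonneg) auto
    finally show ?thesis .
  qed
  have "8 * exp (- 4 * pi\<^sup>2) / real M ^ 5 = 2 * (real M)\<^sup>2 * (1 / (4 * real M) * (?c * ?c))"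
  proof -
    have "exp (- 4 * pi\<^sup>2) = exp (- 2 * pi\<^sup>2) * exp (- 2 * pi\<^sup>2)"
      by (simp flip: exp_add)
    then show ?thesis using M by (simp add: field_simps eval_nat_numeral)
  qed
  also have "\<dots> \<le> real (card ?R) * (1 / (4 * real M) * (?c * ?c))"
  proof (rule mult_right_mono)
    have "2 * M\<^sup>2 \<le> card ?R" by simp
    then show "2 * (real M)\<^sup>2 \<le> real (card ?R)"
      by (metis of_nat_le_iff of_nat_mult of_nat_numeral of_nat_power)
  qed auto
  also have "\<dots> \<le> (\<Sum>r\<in>?R. walk2 M p q (2 * r) i j)"
    using each by (rule sum_bounded_below)
  also have "\<dots> = sum (\<lambda>t. walk2 M p q t i j) ((*) 2 ` ?R)"
    by (subst sum.reindex) (auto simp: inj_on_def)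
  also have "\<dots> \<le> (\<Sum>t\<le>8 * M\<^sup>2. walk2 M p q t i j)"
    using assms by (intro sum_mono2 walk2_nonneg) auto
  finally show ?thesis .
qed

section \<open>The grid sandpile\<close>

lemma ordinary_GRID: "ordinary (GRID n) = Some ` ({1..n} \<times> {1..n})"
  by (auto simp: ordinary_def GRID_def)

definition on_grid :: "(nat \<Rightarrow> nat \<Rightarrow> 'a::zero) \<Rightarrow> (nat \<times> nat) option \<Rightarrow> 'a" where
  "on_grid f v = (case v of None \<Rightarrow> 0 | Some (i, j) \<Rightarrow> f i j)"

text \<open>The frame of positions with a coordinate 0 or \<open>n + 1\<close> stands for the sink.
  As \<open>f\<close> vanishes there, one formula covers interior, sides and corners.\<close>

lemma inflow_GRID:
  fixes f :: "nat \<Rightarrow> nat \<Rightarrow> 'a::comm_semiring_1"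
  assumes ij: "i \<in> {1..n}" "j \<in> {1..n}"
    and f: "\<And>i j. i = 0 \<or> i = n + 1 \<or> j = 0 \<or> j = n + 1 \<Longrightarrow> f i j = 0"
  shows "inflow (GRID n) (on_grid f) (Some (i, j)) =
    f (i - 1) j + f (i + 1) j + f i (j - 1) + f i (j + 1)"
proof -
  let ?Q = "{1..n} \<times> {1..n}"
  let ?N = "{(i - 1, j), (i + 1, j), (i, j - 1), (i, j + 1)}"
  have "inflow (GRID n) (on_grid f) (Some (i, j)) =
      (\<Sum>q\<in>?Q. of_bool (grid_adj q (i, j)) * (case q of (k, l) \<Rightarrow> f k l))"
    unfolding inflow_def ordinary_GRID by (simp add: sum.reindex GRID_def on_grid_def)
  also have "\<dots> = (\<Sum>q | q \<in> ?Q \<and> grid_adj q (i, j). case q of (k, l) \<Rightarrow> f k l)"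
    by (intro sum.mono_neutral_cong_right) auto
  also have "\<dots> = (\<Sum>q\<in>?N. case q of (k, l) \<Rightarrow> f k l)"
  proof (rule sum.mono_neutral_left)
    show "{q. q \<in> ?Q \<and> grid_adj q (i, j)} \<subseteq> ?N"
      by (auto simp: grid_adj_def)
    show "\<forall>q\<in>?N - {q. q \<in> ?Q \<and> grid_adj q (i, j)}. (case q of (k, l) \<Rightarrow> f k l) = 0"
    proof
      fix q assume q: "q \<in> ?N - {q. q \<in> ?Q \<and> grid_adj q (i, j)}"
      obtain k l where kl: "q = (k, l)" by (cases q)
      have "grid_adj q (i, j)"
        using q ij by (auto simp: grid_adj_def)
      with q have "(k, l) \<notin> ?Q" "(k, l) \<in> ?N"
        by (auto simp: kl)
      then have "k = 0 \<or> k = n + 1 \<or> l = 0 \<or> l = n + 1"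
        using ij by auto
      then show "(case q of (k, l) \<Rightarrow> f k l) = 0"
        by (simp add: kl f)
    qed
  qed simp
  also have "\<dots> = f (i - 1) j + f (i + 1) j + f i (j - 1) + f i (j + 1)"
    using ij by (subst sum.insert; force simp: add_ac)+
  finally show ?thesis .
qed

text \<open>The parabola \<open>i * (n + 1 - i)\<close> has second difference -2 in
  \<open>i\<close>; it is constant in \<open>j\<close>, and its cutoff outside the square only
  lowers the inflow.\<close>

lemma dissipative_GRID:
  "dissipative_sandpile (GRID n) (on_grid (\<lambda>i j. if j \<in> {1..n} then i * (n + 1 - i) else 0))"
    (is "dissipative_sandpile _ (on_grid ?f)")
proof (intro dissipative_sandpile.intro dissipative_sandpile_axioms.intro sandpile_GRID)
  fix v assume v: "v \<in> ordinary (GRID n)"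
  then obtain i j where ij: "v = Some (i, j)" "i \<in> {1..n}" "j \<in> {1..n}"
    by (auto simp: ordinary_GRID)
  \<comment> \<open>Writing \<open>i = a + 1\<close> and \<open>n = i + b\<close> removes the
    truncated subtractions.\<close>
  obtain a where a: "i = Suc a" using ij(2) by (cases i) auto
  obtain b where b: "n = i + b" using ij(2) le_Suc_ex by auto
  have "inflow (GRID n) (on_grid ?f) v = ?f (i - 1) j + ?f (i + 1) j + ?f i (j - 1) + ?f i (j + 1)"
    unfolding ij(1) using ij(2,3) by (intro inflow_GRID) auto
  also have "\<dots> \<le> a * (b + 2) + (a + 2) * b + 2 * (i * (b + 1))"
    using ij(3) by (auto simp: a b)
  also have "\<dots> < 4 * (i * (b + 1))"
    by (simp add: a algebra_simps)
  also have "\<dots> = deg (GRID n) v * on_grid ?f v"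
    unfolding deg_GRID[OF v] using ij by (simp add: on_grid_def b)
  finally show "inflow (GRID n) (on_grid ?f) v < deg (GRID n) v * on_grid ?f v" .
qed

text \<open>Each particle has weight at least \<open>c\<close>, of order \<open>M\<close> to the
  power -5, while the total weight is at most \<open>4 * (T + 1)\<close>, of order
  \<open>M^2\<close>; the quotient gives the exponent 7.\<close>

lemma nonrecurrent_GRID_length:
  assumes vs: "set vs \<subseteq> ordinary (GRID n)"
    and nr: "\<not> recurrent (GRID n) (add_particles (GRID n) vs)"
  shows "real (length vs) \<le> 5 * exp (4 * pi\<^sup>2) * real (n + 1) ^ 7"
proof -
  interpret dissipative_sandpile "GRID n" "on_grid (\<lambda>i j. if j \<in> {1..n} then i * (n + 1 - i) else 0)"
    by (rule dissipative_GRID)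
  \<comment> \<open>With \<open>M = n + 1\<close> the absorbing ends 0 and \<open>M\<close> are the
    frame and the interior is \<open>{1..n}\<close>.\<close>
  define M where "M = n + 1"
  have range: "{1..n} = {1..<M}" by (auto simp: M_def)
  obtain v0 where v0: "v0 \<in> ordinary (GRID n)"
    and bound: "\<And>h :: (nat \<times> nat) option \<Rightarrow> real. (\<And>u. u \<in> ordinary (GRID n) \<Longrightarrow> h u \<ge> 0) \<Longrightarrow>
      (\<And>u. u \<in> ordinary (GRID n) - {v0} \<Longrightarrow> deg (GRID n) u * h u \<le> inflow (GRID n) h u) \<Longrightarrow>
      (\<Sum>v\<leftarrow>vs. h v) \<le> (\<Sum>u\<in>ordinary (GRID n). deg (GRID n) u * h u)"
    using nonrecurrent_bound[OF vs nr] by blast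
  obtain p q where pq: "v0 = Some (p, q)" "p \<in> {1..<M}" "q \<in> {1..<M}"
    using v0 by (auto simp: ordinary_GRID M_def)
  define T where "T = 8 * M\<^sup>2"
  define f where "f i j = (\<Sum>t\<le>T. walk2 M p q t i j)" for i j
  define c where "c = 8 * exp (- 4 * pi\<^sup>2) / real M ^ 5"
  have ord: "\<exists>i j. u = Some (i, j) \<and> i \<in> {1..<M} \<and> j \<in> {1..<M}" if "u \<in> ordinary (GRID n)" for u
    using that by (auto simp: ordinary_GRID M_def)
  have lower: "c \<le> on_grid f u" if u: "u \<in> ordinary (GRID n)" for u
    using ord[OF u] sum_walk2_ge[OF pq(2,3)] by (auto simp: on_grid_def f_def T_def c_def)
  have "c > 0" by (simp add: c_def M_def)
  have "(\<Sum>v\<leftarrow>vs. on_grid f v) \<le> (\<Sum>u\<in>ordinary (GRID n). deg (GRID n) u * on_grid f u)"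
  proof (rule bound)
    fix u assume "u \<in> ordinary (GRID n)"
    then show "on_grid f u \<ge> 0"
      using lower \<open>c > 0\<close> by (meson less_le order_trans)
  next
    fix u assume u: "u \<in> ordinary (GRID n) - {v0}"
    obtain i j where ij: "u = Some (i, j)" "i \<in> {1..<M}" "j \<in> {1..<M}"
      using u ord by blast
    let ?S = "\<lambda>t. walk2 M p q t (i - 1) j + walk2 M p q t (i + 1) j +
      walk2 M p q t i (j - 1) + walk2 M p q t i (j + 1)"
    have "inflow (GRID n) (on_grid f) u = f (i - 1) j + f (i + 1) j + f i (j - 1) + f i (j + 1)"
      unfolding ij(1)
    proof (rule inflow_GRID)
      fix i j assume "i = 0 \<or> i = n + 1 \<or> j = 0 \<or> j = n + 1"
      then show "f i j = 0"
        unfolding f_def using walk2_boundary[of i M j] by (intro sum.neutral) (auto simp: M_def)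
    qed (use ij range in auto)
    also have "\<dots> = (\<Sum>t\<le>T. ?S t)"
      by (simp add: f_def sum.distrib)
    \<comment> \<open>Summing the recursion over time telescopes: \<open>8 * f - 4 * f\<close>
      leaves the degree 4 times \<open>f\<close>, up to the first and last terms.\<close>
    also have "\<dots> = (\<Sum>t\<le>T. 8 * walk2 M p q (Suc t) i j - 4 * walk2 M p q t i j)"
      using ij walk2_Suc[of i j M p q] by (intro sum.cong) auto
    also have "\<dots> = 8 * (\<Sum>t\<le>T. walk2 M p q (Suc t) i j) - 4 * f i j"
      by (simp add: f_def sum_subtractf sum_distrib_left)
    also have "(\<Sum>t\<le>T. walk2 M p q (Suc t) i j) = f i j + walk2 M p q (Suc T) i j - walk2 M p q 0 i j"
    proof -
      have "(\<Sum>t\<le>Suc T. walk2 M p q t i j) = walk2 M p q 0 i j + (\<Sum>t\<le>T. walk2 M p q (Suc t) i j)"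
        by (rule sum.atMost_Suc_shift)
      then show ?thesis by (simp add: f_def)
    qed
    \<comment> \<open>The initial mass sits at \<open>v0\<close> alone, so this is where
      \<open>u\<close> must differ from \<open>v0\<close>.\<close>
    also have "walk2 M p q 0 i j = 0"
      using walk2_0[OF pq(2,3) ij(2,3)] u ij(1) pq(1) by auto
    finally have "inflow (GRID n) (on_grid f) u = 4 * f i j + 8 * walk2 M p q (Suc T) i j"
      by simp
    moreover have "walk2 M p q (Suc T) i j \<ge> 0"
      using pq ij by (intro walk2_nonneg) auto
    moreover have "deg (GRID n) u * on_grid f u = 4 * f i j"
      using u by (simp add: deg_GRID) (simp add: ij on_grid_def)
    ultimately show "deg (GRID n) u * on_grid f u \<le> inflow (GRID n) (on_grid f) u"
      by linarith
  qed
  also have "\<dots> = 4 * (\<Sum>u\<in>ordinary (GRID n). on_grid f u)"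
    unfolding sum_distrib_left by (intro sum.cong) (simp_all add: deg_GRID)
  also have "(\<Sum>u\<in>ordinary (GRID n). on_grid f u) = (\<Sum>i=1..<M. \<Sum>j=1..<M. f i j)"
    unfolding ordinary_GRID range
    by (simp add: sum.reindex on_grid_def sum.cartesian_product)
  also have "\<dots> = (\<Sum>t\<le>T. \<Sum>i=1..<M. \<Sum>j=1..<M. walk2 M p q t i j)"
    unfolding f_def by (subst sum.swap[of _ "{..T}"]) (intro sum.cong refl sum.swap)
  also have "\<dots> \<le> (\<Sum>t\<le>T. 1)"
    using pq by (intro sum_mono sum_walk2_le_1)
  also have "\<dots> \<le> 10 * (real M)\<^sup>2"
    using one_le_power[of "real M" 2] by (simp add: T_def M_def del: one_le_power)
  finally have up: "(\<Sum>v\<leftarrow>vs. on_grid f v) \<le> 40 * (real M)\<^sup>2"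
    by simp
  have "real (length vs) * c \<le> (\<Sum>v\<leftarrow>vs. on_grid f v)"
    using vs
  proof (induction vs)
    case (Cons v vs)
    then show ?case using lower[of v] by (simp add: algebra_simps)
  qed simp
  with up have "real (length vs) * c \<le> 40 * (real M)\<^sup>2" by linarith
  then have "real (length vs) \<le> 40 * (real M)\<^sup>2 / c"
    using \<open>c > 0\<close> by (simp add: field_simps)
  also have "\<dots> = 5 * exp (4 * pi\<^sup>2) * real M ^ 7"
    by (simp add: c_def exp_minus field_simps eval_nat_numeral)
  finally show ?thesis by (simp add: M_def)
qed

theorem theorem7:
  "\<exists>C::real. \<forall>n::nat. n \<ge> 1 \<longrightarrow> ereal_of_enat (tcl (GRID n)) \<le> ereal (C * real n ^ 7)"
proof (intro exI allI impI)
  fix n :: nat assume n: "n \<ge> 1"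
  \<comment> \<open>\<open>640 = 5 * 2 ^ 7\<close>, from \<open>n + 1 \<le> 2 * n\<close>.\<close>
  let ?C = "640 * exp (4 * pi\<^sup>2)"
  \<comment> \<open>Lengths are natural numbers, so rounding the real bound down loses nothing and
    gives a finite bound in \<open>enat\<close>.\<close>
  let ?B = "nat \<lfloor>?C * real n ^ 7\<rfloor>"
  have "tcl (GRID n) \<le> enat ?B"
    unfolding tcl_def
  proof (rule Sup_least)
    fix N assume "N \<in> {enat (length vs) | vs. set vs \<subseteq> ordinary (GRID n) \<and>
      (\<forall>k\<le>length vs. \<not> recurrent (GRID n) (add_particles (GRID n) (take k vs)))}"
    then obtain vs where N: "N = enat (length vs)" and vs: "set vs \<subseteq> ordinary (GRID n)"
      and nr: "\<forall>k\<le>length vs. \<not> recurrent (GRID n) (add_particles (GRID n) (take k vs))"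
      by blast
    have "\<not> recurrent (GRID n) (add_particles (GRID n) vs)"
      using nr by auto
    then have "real (length vs) \<le> 5 * exp (4 * pi\<^sup>2) * real (n + 1) ^ 7"
      using nonrecurrent_GRID_length vs by blast
    also have "\<dots> \<le> 5 * exp (4 * pi\<^sup>2) * (2 * real n) ^ 7"
      using n by (intro mult_left_mono power_mono) auto
    also have "\<dots> = ?C * real n ^ 7"
      by (simp add: power_mult_distrib)
    finally show "N \<le> enat ?B"
      by (simp add: N le_nat_floor)
  qed
  then have "ereal_of_enat (tcl (GRID n)) \<le> ereal_of_enat (enat ?B)"
    by (simp only: ereal_of_enat_le_iff)
  also have "\<dots> \<le> ereal (?C * real n ^ 7)"
    by simp
  finally show "ereal_of_enat (tcl (GRID n)) \<le> ereal (?C * real n ^ 7)" .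
qed

end
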